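(* Let $d\ge1$, let $T \in \mathrm{GL}(2d,\mathbb R)$ and suppose that there exists a linear or antilinear bounded invertible operator $F$ on $L^2(\mathbb R^d)$ such that, for all lattices $\Lambda \subset \mathbb R^{2d}$ and all $g, h \in L^2(\mathbb R^d)$, the following holds: (i) $\mathcal G(F g, T \Lambda)$ is a Bessel sequence if and only if $\mathcal G(g, \Lambda)$ is a Bessel sequence; (ii) $F S_{g, h}^\Lambda F^{-1} = S_{F g, F h}^{T \Lambda}$ whenever $\mathcal G(g, \Lambda)$ and $\mathcal G(h, \Lambda)$ are Bessel sequences. Then either $T$ or $R T$ is symplectic, where $R=\begin{pmatrix} I & 0\\ 0 & -I\end{pmatrix}$ with $d\times d$ blocks.
   Context: A matrix $S\in \mathrm{GL}(2d,\mathbb R)$ is symplectic if $S^TJS=J$, where $J = \begin{pmatrix} 0 & I \\ -I & 0\end{pmatrix}$. A map $F$ on $L^2(\mathbb R^d)$ is antilinear if $F(\alpha f+\beta g)=\overline{\alpha}Ff+\overline{\beta}Fg$ for all $f,g \in L^2(\mathbb R^d)$ and $\alpha,\beta\in\mathbb C$; boundedness is defined as for linear operators. For $z=(x,\omega)\in\mathbb R^{d}\times\mathbb R^d$, $\pi(z)f(t)=e^{2\pi i t\cdot\omega}f(t-x)$ on $L^2(\mathbb R^d)$. A lattice in $\mathbb R^{2d}$ is a set $\Lambda=A\mathbb Z^{2d}$ with $A\in\mathrm{GL}(2d,\mathbb R)$. For $g\in L^2(\mathbb R^d)$ the Gabor system is $\mathcal G(g,\Lambda)=\{\pi(z)g :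 z\in\Lambda\}$; it is a Bessel sequence if there is $C>0$ with $\sum_{z\in\Lambda}|\langle f,\pi(z)g\rangle|^2\le C\|f\|^2$ for all $f\in L^2(\mathbb R^d)$. If $\mathcal G(g,\Lambda)$ and $\mathcal G(h,\Lambda)$ are Bessel sequences, the (mixed-type) frame operator is the bounded linear operator $S^\Lambda_{g,h}f=\sum_{z\in\Lambda}\langle f,\pi(z)g\rangle\pi(z)h$ on $L^2(\mathbb R^d)$. Inner products are linear in the first argument. *)

theory Defs
  imports "HOL-Analysis.Analysis"
begin

section \<open>The Hilbert space of square-integrable functions\<close>

definition square_integrable :: "(real^'n \<Rightarrow> complex) \<Rightarrow> bool" where
  "square_integrable f \<longleftrightarrow>
     f \<in> borel_measurable lborel \<and> integrable lborel (\<lambda>x. (cmod (f x))\<^sup>2)"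

lemma square_integrable_add:
  assumes "square_integrable f" "square_integrable g"
  shows "square_integrable (\<lambda>x. f x + g x)"
proof -
  have [measurable]: "f \<in> borel_measurable lborel" "g \<in> borel_measurable lborel"
    using assms by (auto simp: square_integrable_def)
  have bound: "integrable lborel (\<lambda>x. 2 * (cmod (f x))\<^sup>2 + 2 * (cmod (g x))\<^sup>2)"
    using assms by (auto simp: square_integrable_def)
  have "(cmod (f x + g x))\<^sup>2 \<le> 2 * (cmod (f x))\<^sup>2 + 2 * (cmod (g x))\<^sup>2" for x
  proof -
    have "(cmod (f x + g x))\<^sup>2 \<le> (cmod (f x) + cmod (g x))\<^sup>2"
      by (intro power_mono norm_triangle_ineq) auto
    also have "\<dots> \<le> 2 * (cmod (f x))\<^sup>2 + 2 * (cmod (g x))\<^sup>2"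
      using sum_squares_bound[of "cmod (f x)" "cmod (g x)"] by (simp add: power2_sum)
    finally show ?thesis .
  qed
  then have "integrable lborel (\<lambda>x. (cmod (f x + g x))\<^sup>2)"
    by (intro Bochner_Integration.integrable_bound[OF bound]) auto
  then show ?thesis
    by (simp add: square_integrable_def)
qed

lemma square_integrable_cmult:
  "square_integrable f \<Longrightarrow> square_integrable (\<lambda>x. c * f x)"
  by (auto simp: square_integrable_def norm_mult power_mult_distrib)

lemma square_integrable_zero: "square_integrable (\<lambda>x. 0)"
  by (simp add: square_integrable_def)

lemma square_integrable_mult_cnj:
  assumes "square_integrable f" "square_integrable g"
  shows "integrable lborel (\<lambda>x. f x * cnj (g x))"
proof -
  have [measurable]: "f \<in> borel_measurable lborel" "g \<in> borel_measurable lborel"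
    using assms by (auto simp: square_integrable_def)
  have [measurable]: "cnj \<in> borel_measurable borel"
    by (intro borel_measurable_continuous_onI continuous_intros)
  have bound: "integrable lborel (\<lambda>x. (cmod (f x))\<^sup>2 + (cmod (g x))\<^sup>2)"
    using assms by (auto simp: square_integrable_def)
  moreover have "(\<lambda>x. f x * cnj (g x)) \<in> borel_measurable lborel"
    by measurable
  moreover have "cmod (f x * cnj (g x)) \<le> (cmod (f x))\<^sup>2 + (cmod (g x))\<^sup>2" for x
  proof -
    have "0 \<le> cmod (f x) * cmod (g x)" by simp
    then show ?thesis
      using sum_squares_bound[of "cmod (f x)" "cmod (g x)"] unfolding norm_mult complex_mod_cnj
      by linarith
  qed
  ultimately show ?thesis
    by (intro Bochner_Integration.integrable_bound[OF bound]) auto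
qed

quotient_type 'n l2 = "real^'n \<Rightarrow> complex" / partial:
  "\<lambda>f g. square_integrable f \<and> square_integrable g \<and> (AE x in lborel. f x = g x)"
proof (rule part_equivpI)
  show "\<exists>f::real^'n \<Rightarrow> complex. square_integrable f \<and> square_integrable f \<and> (AE x in lborel. f x = f x)"
    using square_integrable_zero by auto
qed (auto intro!: sympI transpI)

instantiation l2 :: (finite) real_inner
begin

lift_definition zero_l2 :: "'a l2" is "\<lambda>x. 0"
  by (simp add: square_integrable_zero)

lift_definition plus_l2 :: "'a l2 \<Rightarrow> 'a l2 \<Rightarrow> 'a l2" is "\<lambda>f g x. f x + g x"
  by (auto intro: square_integrable_add)

lift_definition uminus_l2 :: "'a l2 \<Rightarrow> 'a l2" is "\<lambda>f x. - f x"
  by (simp add: square_integrable_def)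

definition minus_l2 :: "'a l2 \<Rightarrow> 'a l2 \<Rightarrow> 'a l2" where
  "minus_l2 f g = f + - g"

lift_definition scaleR_l2 :: "real \<Rightarrow> 'a l2 \<Rightarrow> 'a l2" is "\<lambda>r f x. complex_of_real r * f x"
  by (auto intro: square_integrable_cmult)

lift_definition inner_l2 :: "'a l2 \<Rightarrow> 'a l2 \<Rightarrow> real" is
  "\<lambda>f g. Re (\<integral>x. f x * cnj (g x) \<partial>lborel)"
proof -
  fix f f' g g' :: "real^'a \<Rightarrow> complex"
  assume *: "square_integrable f \<and> square_integrable f' \<and> (AE x in lborel. f x = f' x)"
    "square_integrable g \<and> square_integrable g' \<and> (AE x in lborel. g x = g' x)"
  have "(\<integral>x. f x * cnj (g x) \<partial>lborel) = (\<integral>x. f' x * cnj (g' x) \<partial>lborel)"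
    using * square_integrable_mult_cnj[of f g] square_integrable_mult_cnj[of f' g']
    by (intro integral_cong_AE) auto
  then show "Re (\<integral>x. f x * cnj (g x) \<partial>lborel) = Re (\<integral>x. f' x * cnj (g' x) \<partial>lborel)"
    by simp
qed

definition norm_l2 :: "'a l2 \<Rightarrow> real" where
  "norm_l2 f = sqrt (inner f f)"

definition sgn_l2 :: "'a l2 \<Rightarrow> 'a l2" where
  "sgn_l2 f = inverse (norm f) *\<^sub>R f"

definition dist_l2 :: "'a l2 \<Rightarrow> 'a l2 \<Rightarrow> real" where
  "dist_l2 f g = norm (f - g)"

definition uniformity_l2 :: "('a l2 \<times> 'a l2) filter" where
  "uniformity_l2 = (INF e\<in>{0<..}. principal {(f, g). dist f g < e})"

definition open_l2 :: "'a l2 set \<Rightarrow> bool" where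
  "open_l2 U \<longleftrightarrow> (\<forall>f\<in>U. \<forall>\<^sub>F (f', g) in uniformity. f' = f \<longrightarrow> g \<in> U)"

instance
proof
  fix f g h :: "'a l2" and r s :: real
  show "f + g + h = f + (g + h)"
    by transfer (auto simp: algebra_simps intro!: square_integrable_add)
  show "f + g = g + f"
    by transfer (auto simp: algebra_simps intro!: square_integrable_add)
  show "0 + f = f"
    by transfer auto
  show "- f + f = 0"
    by transfer (auto simp: square_integrable_zero)
  show "f - g = f + - g"
    by (rule minus_l2_def)
  show "r *\<^sub>R (f + g) = r *\<^sub>R f + r *\<^sub>R g"
    by transfer (simp add: distrib_left square_integrable_add square_integrable_cmult)
  show "(r + s) *\<^sub>R f = r *\<^sub>R f + s *\<^sub>R f"
    by transfer (simp add: distrib_right square_integrable_add square_integrable_cmult)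
  show "r *\<^sub>R s *\<^sub>R f = (r * s) *\<^sub>R f"
    by transfer (simp add: mult.assoc square_integrable_cmult)
  show "1 *\<^sub>R f = f"
    by transfer auto
  show "norm f = sqrt (inner f f)"
    by (rule norm_l2_def)
  show "sgn f = inverse (norm f) *\<^sub>R f"
    by (rule sgn_l2_def)
  show "dist f g = norm (f - g)"
    by (rule dist_l2_def)
  show "uniformity = (INF e\<in>{0<..}. principal {(f::'a l2, g). dist f g < e})"
    by (rule uniformity_l2_def)
  show "open U \<longleftrightarrow> (\<forall>f\<in>U. \<forall>\<^sub>F (f', g) in uniformity. f' = f \<longrightarrow> g \<in> U)" for U :: "'a l2 set"
    by (rule open_l2_def)
  show "inner f g = inner g f"
  proof transfer
    fix f g :: "real^'a \<Rightarrow> complex"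
    have "(\<integral>x. g x * cnj (f x) \<partial>lborel) = (\<integral>x. cnj (f x * cnj (g x)) \<partial>lborel)"
      by (simp add: mult.commute)
    also have "\<dots> = cnj (\<integral>x. f x * cnj (g x) \<partial>lborel)"
      by (rule Bochner_Integration.integral_cnj)
    finally show "Re (\<integral>x. f x * cnj (g x) \<partial>lborel) = Re (\<integral>x. g x * cnj (f x) \<partial>lborel)"
      by simp
  qed
  show "inner (f + g) h = inner f h + inner g h"
    by transfer (simp add: distrib_right square_integrable_mult_cnj)
  show "inner (r *\<^sub>R f) g = r * inner f g"
    by transfer (simp add: mult.assoc)
  have *: "(\<integral>x. F x * cnj (F x) \<partial>lborel) = complex_of_real (\<integral>x. (cmod (F x))\<^sup>2 \<partial>lborel)"
    for F :: "real^'a \<Rightarrow> complex"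
    unfolding complex_norm_square[symmetric] by (simp del: of_real_power)
  show "0 \<le> inner f f"
    by transfer (simp add: *)
  show "inner f f = 0 \<longleftrightarrow> f = 0"
    by transfer (auto simp: * square_integrable_zero square_integrable_def integral_nonneg_eq_0_iff_AE)
qed

end

lift_definition scaleC_l2 :: "complex \<Rightarrow> 'n::finite l2 \<Rightarrow> 'n l2"  (infixr \<open>*\<^sub>C\<close> 75) is
  "\<lambda>c f x. c * f x"
  by (auto intro: square_integrable_cmult)

lift_definition cinner_l2 :: "'n::finite l2 \<Rightarrow> 'n l2 \<Rightarrow> complex" is
  "\<lambda>f g. \<integral>x. f x * cnj (g x) \<partial>lborel"
proof -
  fix f f' g g' :: "real^'n \<Rightarrow> complex"
  assume *: "square_integrable f \<and> square_integrable f' \<and> (AE x in lborel. f x = f' x)"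
    "square_integrable g \<and> square_integrable g' \<and> (AE x in lborel. g x = g' x)"
  show "(\<integral>x. f x * cnj (g x) \<partial>lborel) = (\<integral>x. f' x * cnj (g' x) \<partial>lborel)"
    using * square_integrable_mult_cnj[of f g] square_integrable_mult_cnj[of f' g']
    by (intro integral_cong_AE) auto
qed

definition linear_l2 :: "('n::finite l2 \<Rightarrow> 'n l2) \<Rightarrow> bool" where
  "linear_l2 F \<longleftrightarrow> (\<forall>\<alpha> \<beta> f g. F (\<alpha> *\<^sub>C f + \<beta> *\<^sub>C g) = \<alpha> *\<^sub>C F f + \<beta> *\<^sub>C F g)"

definition antilinear_l2 :: "('n::finite l2 \<Rightarrow> 'n l2) \<Rightarrow> bool" where
  "antilinear_l2 F \<longleftrightarrow> (\<forall>\<alpha> \<beta> f g. F (\<alpha> *\<^sub>C f + \<beta> *\<^sub>C g) = cnj \<alpha> *\<^sub>C F f + cnj \<beta> *\<^sub>C F g)"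

definition bounded_l2 :: "('n::finite l2 \<Rightarrow> 'n l2) \<Rightarrow> bool" where
  "bounded_l2 F \<longleftrightarrow> (\<exists>K. \<forall>f. norm (F f) \<le> K * norm f)"


section \<open>Phase space\<close>

text \<open>
  Phase space \<open>\<real>\<^sup>d \<times> \<real>\<^sup>d\<close> is \<^typ>\<open>real^('n + 'n)\<close> with \<open>d = CARD('n)\<close>: the indices \<open>Inl i\<close> carry the
  position \<open>x\<close>, the indices \<open>Inr i\<close> the frequency \<open>\<omega>\<close>.
\<close>

definition position :: "real^('n::finite + 'n) \<Rightarrow> real^'n" where
  "position z = (\<chi> i. z $ Inl i)"

definition frequency :: "real^('n::finite + 'n) \<Rightarrow> real^'n" where
  "frequency z = (\<chi> i. z $ Inr i)"

definition block_matrix ::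
  "real^'n^'n \<Rightarrow> real^'n^'n \<Rightarrow> real^'n^'n \<Rightarrow> real^'n^'n \<Rightarrow> real^('n::finite + 'n)^('n + 'n)" where
  "block_matrix A B C D = (\<chi> i j.
     case i of
       Inl k \<Rightarrow> (case j of Inl l \<Rightarrow> A $ k $ l | Inr l \<Rightarrow> B $ k $ l)
     | Inr k \<Rightarrow> (case j of Inl l \<Rightarrow> C $ k $ l | Inr l \<Rightarrow> D $ k $ l))"

definition symplectic_form_matrix :: "real^('n::finite + 'n)^('n + 'n)" where
  "symplectic_form_matrix = block_matrix 0 (mat 1) (- mat 1) 0"

definition reflection_matrix :: "real^('n::finite + 'n)^('n + 'n)" where
  "reflection_matrix = block_matrix (mat 1) 0 0 (- mat 1)"

definition symplectic :: "real^('n::finite + 'n)^('n + 'n) \<Rightarrow> bool" where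
  "symplectic S \<longleftrightarrow>
     invertible S \<and> transpose S ** symplectic_form_matrix ** S = symplectic_form_matrix"

definition is_lattice :: "(real^'m) set \<Rightarrow> bool" where
  "is_lattice \<Lambda> \<longleftrightarrow>
     (\<exists>A::real^'m^'m. invertible A \<and> \<Lambda> = (\<lambda>k. A *v k) ` {k. \<forall>i. k $ i \<in> \<int>})"


section \<open>Gabor systems\<close>

lift_definition tf_shift :: "real^('n::finite + 'n) \<Rightarrow> 'n l2 \<Rightarrow> 'n l2" is
  "\<lambda>z f t. cis (2 * pi * (t \<bullet> frequency z)) * f (t - position z)"
proof -
  fix z :: "real^('n + 'n)" and f g :: "real^'n \<Rightarrow> complex"
  let ?p = "- position z"
  have sq: "square_integrable (\<lambda>t. cis (2 * pi * (t \<bullet> frequency z)) * h (t - position z))"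
    if h: "square_integrable h" for h
  proof -
    have [measurable]: "h \<in> borel_measurable borel"
      using h by (simp add: square_integrable_def)
    have "integrable (distr lborel borel ((+) ?p)) (\<lambda>t. (cmod (h t))\<^sup>2)"
      using h by (simp add: square_integrable_def lborel_distr_plus)
    then have "integrable lborel (\<lambda>t. (cmod (h (?p + t)))\<^sup>2)"
      by (subst (asm) integrable_distr_eq) auto
    moreover have "(\<lambda>t. cis (2 * pi * (t \<bullet> frequency z))) \<in> borel_measurable borel"
      by (intro borel_measurable_continuous_onI continuous_intros)
    ultimately show ?thesis
      by (auto simp: square_integrable_def norm_mult)
  qed
  assume *: "square_integrable f \<and> square_integrable g \<and> (AE x in lborel. f x = g x)"
  then have [measurable]: "f \<in> borel_measurable borel" "g \<in> borel_measurable borel"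
    by (auto simp: square_integrable_def)
  have "AE t in distr lborel borel ((+) ?p). f t = g t"
    unfolding lborel_distr_plus using * by blast
  then have "AE t in lborel. f (?p + t) = g (?p + t)"
    by (subst (asm) AE_distr_iff) auto
  then show "square_integrable (\<lambda>t. cis (2 * pi * (t \<bullet> frequency z)) * f (t - position z)) \<and>
    square_integrable (\<lambda>t. cis (2 * pi * (t \<bullet> frequency z)) * g (t - position z)) \<and>
    (AE t in lborel. cis (2 * pi * (t \<bullet> frequency z)) * f (t - position z) =
       cis (2 * pi * (t \<bullet> frequency z)) * g (t - position z))"
    using * sq by auto
qed

definition bessel :: "'n::finite l2 \<Rightarrow> (real^('n + 'n)) set \<Rightarrow> bool" where
  "bessel g \<Lambda> \<longleftrightarrow>
     (\<exists>C>0. \<forall>f. (\<lambda>z. (cmod (cinner_l2 f (tf_shift z g)))\<^sup>2) summable_on \<Lambda> \<and>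
       (\<Sum>\<^sub>\<infinity>z\<in>\<Lambda>. (cmod (cinner_l2 f (tf_shift z g)))\<^sup>2) \<le> C * (norm f)\<^sup>2)"

text \<open>
  The sum is the unconditional limit in the \<open>L\<^sup>2\<close> norm; it exists whenever both Gabor systems are
  Bessel sequences, the only case in which the operator is considered.
\<close>

definition frame_op ::
  "(real^('n + 'n)) set \<Rightarrow> 'n::finite l2 \<Rightarrow> 'n l2 \<Rightarrow> 'n l2 \<Rightarrow> 'n l2" where
  "frame_op \<Lambda> g h f = (\<Sum>\<^sub>\<infinity>z\<in>\<Lambda>. cinner_l2 f (tf_shift z g) *\<^sub>C tf_shift z h)"

end

theory Submission
  imports Defs
begin

text \<open>
  Let \<open>g\<close> be the indicator function of the unit cube. For every \<open>z\<close> with a position coordinate of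
  modulus at least 2 there is a lattice \<open>\<Lambda>\<close> in which \<open>z\<close> is primitive and for which \<open>\<G>(g, \<Lambda>)\<close> is
  orthonormal. On sublattices \<open>\<Lambda>' \<subseteq> \<Lambda>\<close>, the operator \<open>S\<^sub>g\<^sub>,\<^sub>h\<close> then sends \<open>\<pi>(z)g\<close> to \<open>\<pi>(z)h\<close> or to \<open>0\<close>
  according to whether \<open>z \<in> \<Lambda>'\<close>. Comparing the resulting expansions of \<open>F \<pi>(z)h\<close> for different
  sublattices shows that \<open>\<G>(F g, T \<Lambda>)\<close> is orthonormal and that only the terms \<open>\<pi>(\<plusminus>T z)F h\<close> survive; a
  comparison with \<open>2z\<close> excludes one of the two signs. Hence \<open>F \<pi>(z)h = a \<pi>(\<plusminus>T z)F h\<close> for all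
  time-frequency shifts \<open>h\<close> of \<open>g\<close>, and the commutation relations give
  \<open>\<sigma>(T z, T w) = \<plusminus>\<sigma>(z, w)\<close> modulo 1. Scaling \<open>w\<close> removes the modulus, and linear algebra makes the sign
  independent of \<open>z\<close> and \<open>w\<close>.
\<close>

section \<open>The complex Hilbert space structure and time-frequency shifts\<close>

lemma scaleC_add_right: "c *\<^sub>C (f + g) = c *\<^sub>C f + c *\<^sub>C g"
  by transfer (simp add: distrib_left square_integrable_add square_integrable_cmult)

lemma scaleC_scaleC: "c *\<^sub>C d *\<^sub>C f = (c * d) *\<^sub>C f"
  by transfer (simp add: mult.assoc square_integrable_cmult)

lemma scaleC_one [simp]: "1 *\<^sub>C f = f"
  by transfer simp

lemma scaleC_zero_left [simp]: "0 *\<^sub>C f = 0"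
  by transfer (simp add: square_integrable_zero)

lemma scaleC_add_left: "(c + d) *\<^sub>C f = c *\<^sub>C f + d *\<^sub>C f"
  by transfer (simp add: distrib_right square_integrable_add square_integrable_cmult)

lemma Re_cinner: "Re (cinner_l2 f g) = inner f g"
  by transfer simp

lemma cinner_add_left: "cinner_l2 (f + g) h = cinner_l2 f h + cinner_l2 g h"
  by transfer (simp add: distrib_right square_integrable_mult_cnj)

lemma cinner_scaleC_left: "cinner_l2 (c *\<^sub>C f) g = c * cinner_l2 f g"
  by transfer (simp add: mult.assoc)

lemma cinner_commute: "cinner_l2 g f = cnj (cinner_l2 f g)"
proof transfer
  fix f g :: "real^'a \<Rightarrow> complex"
  have "(\<integral>x. g x * cnj (f x) \<partial>lborel) = (\<integral>x. cnj (f x * cnj (g x)) \<partial>lborel)"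
    by (simp add: mult.commute)
  also have "\<dots> = cnj (\<integral>x. f x * cnj (g x) \<partial>lborel)"
    by (rule Bochner_Integration.integral_cnj)
  finally show "(\<integral>x. g x * cnj (f x) \<partial>lborel) = cnj (\<integral>x. f x * cnj (g x) \<partial>lborel)" .
qed

lemma cinner_scaleC_right: "cinner_l2 f (c *\<^sub>C g) = cnj c * cinner_l2 f g"
  by (metis cinner_scaleC_left cinner_commute complex_cnj_mult)

lemma cinner_zero_left [simp]: "cinner_l2 0 f = 0"
  by (metis cinner_scaleC_left mult_zero_left scaleC_zero_left)

lemma cinner_zero_right [simp]: "cinner_l2 f 0 = 0"
  by (metis cinner_commute cinner_zero_left complex_cnj_zero)

lemma Im_cinner: "Im (cinner_l2 f g) = inner f (\<i> *\<^sub>C g)"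
  using Re_cinner[of f "\<i> *\<^sub>C g"] by (simp add: cinner_scaleC_right)

lemma cinner_self: "cinner_l2 f f = complex_of_real ((norm f)\<^sup>2)"
proof (rule complex_eqI)
  show "Im (cinner_l2 f f) = Im (complex_of_real ((norm f)\<^sup>2))"
    using cinner_commute[of f f] by (metis Im_complex_of_real Reals_cnj_iff complex_is_Real_iff)
qed (simp add: Re_cinner power2_norm_eq_inner)

text \<open>Allows a convergent infinite sum to be paired termwise with a fixed vector. Real and
  imaginary parts are real inner products with \<open>g\<close> and with
  \<open>\<i> *\<^sub>C g\<close>, whose boundedness is known.\<close>

lemma bounded_linear_cinner_left: "bounded_linear (\<lambda>f. cinner_l2 f g)"
proof -
  have "(\<lambda>f. cinner_l2 f g) = (\<lambda>f. complex_of_real (inner f g) + \<i> * complex_of_real (inner f (\<i> *\<^sub>C g)))"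
    by (auto simp: complex_eq_iff Re_cinner Im_cinner)
  moreover have "bounded_linear \<dots>"
    by (intro bounded_linear_add bounded_linear_mult_right[THEN bounded_linear_compose]
      bounded_linear_of_real[THEN bounded_linear_compose] bounded_linear_inner_left)
  ultimately show ?thesis by simp
qed

lemma norm_scaleC: "norm (c *\<^sub>C f) = cmod c * norm f"
proof -
  have "complex_of_real ((norm (c *\<^sub>C f))\<^sup>2) = complex_of_real ((cmod c * norm f)\<^sup>2)"
    unfolding cinner_self[symmetric] power_mult_distrib of_real_mult complex_norm_square[of c]
    by (simp add: cinner_scaleC_left cinner_scaleC_right mult.assoc)
  then show ?thesis
    by (simp only: of_real_eq_iff power2_eq_iff_nonneg norm_ge_zero mult_nonneg_nonneg)
qed

lemma scaleC_eq_0_iff [simp]: "c *\<^sub>C f = 0 \<longleftrightarrow> c = 0 \<or> f = 0"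
  by (metis norm_scaleC norm_eq_zero mult_eq_0_iff)

lemma scaleC_cancel_right: "c *\<^sub>C f = d *\<^sub>C f \<Longrightarrow> f \<noteq> 0 \<Longrightarrow> c = d"
  using scaleC_add_left[of c "- d" f] scaleC_add_left[of d "- d" f]
  by (metis add.right_inverse eq_neg_iff_add_eq_0 scaleC_eq_0_iff add.inverse_inverse)

section \<open>Composition laws of time-frequency shifts\<close>

lemma position_add: "position (z + w) = position z + position w"
  and frequency_add: "frequency (z + w) = frequency z + frequency w"
  by (simp_all add: position_def frequency_def vec_eq_iff)

lemma position_zero [simp]: "position 0 = 0" and frequency_zero [simp]: "frequency 0 = 0"
  by (simp_all add: position_def frequency_def vec_eq_iff)

lemma tf_shift_square_integrable:
  "square_integrable f \<Longrightarrow> square_integrable (\<lambda>t. cis (2 * pi * (t \<bullet> frequency z)) * f (t - position z))"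
  using tf_shift.rsp unfolding rel_fun_def by blast

lemma tf_shift_add: "tf_shift z (f + g) = tf_shift z f + tf_shift z g"
  by transfer (simp add: distrib_left square_integrable_add tf_shift_square_integrable)

lemma tf_shift_scaleC: "tf_shift z (c *\<^sub>C f) = c *\<^sub>C tf_shift z f"
proof transfer
  fix z :: "real^('a+'a)" and c and f :: "real^'a \<Rightarrow> complex"
  assume "square_integrable f \<and> square_integrable f \<and> (AE x in lborel. f x = f x)"
  then have f: "square_integrable f" by simp
  show "square_integrable (\<lambda>t. cis (2 * pi * (t \<bullet> frequency z)) * (c * f (t - position z))) \<and>
    square_integrable (\<lambda>x. c * (cis (2 * pi * (x \<bullet> frequency z)) * f (x - position z))) \<and>
    (AE x in lborel. cis (2 * pi * (x \<bullet> frequency z)) * (c * f (x - position z)) =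
       c * (cis (2 * pi * (x \<bullet> frequency z)) * f (x - position z)))"
    using tf_shift_square_integrable[OF square_integrable_cmult[OF f], of z c]
    by (simp add: mult.left_commute)
qed

lemma tf_shift_0 [simp]: "tf_shift 0 f = f"
  by transfer simp

text \<open>Translating by the position of \<open>z\<close> also translates the argument of the
  modulation belonging to \<open>w\<close>; this produces the constant phase.\<close>

lemma tf_shift_tf_shift:
  "tf_shift z (tf_shift w f) = cis (- 2 * pi * (position z \<bullet> frequency w)) *\<^sub>C tf_shift (z + w) f"
proof transfer
  fix z w :: "real^('a+'a)" and f :: "real^'a \<Rightarrow> complex"
  let ?l = "\<lambda>t. cis (2 * pi * (t \<bullet> frequency z)) *
    (cis (2 * pi * ((t - position z) \<bullet> frequency w)) * f (t - position z - position w))"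
  let ?r = "\<lambda>x. cis (- 2 * pi * (position z \<bullet> frequency w)) *
    (cis (2 * pi * (x \<bullet> frequency (z + w))) * f (x - position (z + w)))"
  assume "square_integrable f \<and> square_integrable f \<and> (AE x in lborel. f x = f x)"
  then have "square_integrable ?l"
    by (intro tf_shift_square_integrable) simp
  moreover have "?l = ?r"
  proof
    fix t
    have cis_cong: "cis a * (cis b * y) = cis c * (cis d * y)" if "a + b = c + d" for a b c d y
      using that by (metis cis_mult mult.assoc)
    show "?l t = ?r t"
      unfolding position_add frequency_add diff_diff_eq
      by (intro cis_cong) (simp add: algebra_simps)
  qed
  ultimately have "square_integrable ?l" "square_integrable ?r" "?l = ?r"
    by simp_all
  moreover from \<open>?l = ?r\<close> have "AE x in lborel. ?l x = ?r x"
    by (intro AE_I2) (rule fun_cong)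
  ultimately show "square_integrable ?l \<and> square_integrable ?r \<and> (AE x in lborel. ?l x = ?r x)"
    by blast
qed

text \<open>The modulations cancel because they have modulus 1, and Lebesgue measure is invariant
  under the translation.\<close>

lemma cinner_tf_shift [simp]: "cinner_l2 (tf_shift z f) (tf_shift z g) = cinner_l2 f g"
proof transfer
  fix z :: "real^('a+'a)" and f g :: "real^'a \<Rightarrow> complex"
  assume "square_integrable f \<and> square_integrable f \<and> (AE x in lborel. f x = f x)"
    "square_integrable g \<and> square_integrable g \<and> (AE x in lborel. g x = g x)"
  then have [measurable]: "f \<in> borel_measurable borel" "g \<in> borel_measurable borel"
    by (auto simp: square_integrable_def)
  have [measurable]: "cnj \<in> borel_measurable borel"
    by (intro borel_measurable_continuous_onI continuous_intros)
  have "(cis (2 * pi * (x \<bullet> frequency z)) * f (x - position z) *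
      cnj (cis (2 * pi * (x \<bullet> frequency z)) * g (x - position z))) =
      f (- position z + x) * cnj (g (- position z + x))" for x
    by (simp add: cis_cnj cis_mult mult.assoc mult.left_commute[of _ "cis _"] flip: cis_inverse)
  then have "(\<integral>x. cis (2 * pi * (x \<bullet> frequency z)) * f (x - position z) *
      cnj (cis (2 * pi * (x \<bullet> frequency z)) * g (x - position z)) \<partial>lborel) =
      (\<integral>x. f (- position z + x) * cnj (g (- position z + x)) \<partial>lborel)"
    by (intro Bochner_Integration.integral_cong refl)
  also have "\<dots> = (\<integral>x. f x * cnj (g x) \<partial>distr lborel borel ((+) (- position z)))"
    by (subst integral_distr) auto
  also have "\<dots> = (\<integral>x. f x * cnj (g x) \<partial>lborel)"
    by (simp add: lborel_distr_plus)
  finally show "(\<integral>x. cis (2 * pi * (x \<bullet> frequency z)) * f (x - position z) *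
      cnj (cis (2 * pi * (x \<bullet> frequency z)) * g (x - position z)) \<partial>lborel) =
      (\<integral>x. f x * cnj (g x) \<partial>lborel)" .
qed

lemma norm_tf_shift [simp]: "norm (tf_shift z f) = norm f"
proof -
  have "complex_of_real ((norm (tf_shift z f))\<^sup>2) = complex_of_real ((norm f)\<^sup>2)"
    unfolding cinner_self[symmetric] by simp
  then show ?thesis
    by (simp only: of_real_eq_iff power2_eq_iff_nonneg norm_ge_zero)
qed

lemma tf_shift_eq_0_iff [simp]: "tf_shift z f = 0 \<longleftrightarrow> f = 0"
  unfolding norm_eq_zero[of "tf_shift z f", symmetric] norm_eq_zero[of f, symmetric] by simp

section \<open>Orthogonal Gabor systems and covariant operators\<close>

definition symplectic_form :: "real^('n::finite + 'n) \<Rightarrow> real^('n + 'n) \<Rightarrow> real" where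
  "symplectic_form z w = position z \<bullet> frequency w - position w \<bullet> frequency z"

text \<open>Both compositions are multiples of the shift by \<open>z + w\<close>; the quotient of
  their phases is the exponential of the symplectic form. Through this relation the form becomes
  visible to \<open>F\<close>.\<close>

lemma tf_shift_commute:
  "tf_shift z (tf_shift w f) = cis (- 2 * pi * symplectic_form z w) *\<^sub>C tf_shift w (tf_shift z f)"
  unfolding symplectic_form_def tf_shift_tf_shift add.commute[of w z] scaleC_scaleC cis_mult
  by (simp add: algebra_simps)

lemma cinner_tf_shift_tf_shift:
  "cinner_l2 (tf_shift z f) (tf_shift w g) =
    cis (- 2 * pi * (position z \<bullet> frequency (w - z))) * cinner_l2 f (tf_shift (w - z) g)"
proof -
  have "tf_shift w g = cis (2 * pi * (position z \<bullet> frequency (w - z))) *\<^sub>C tf_shift z (tf_shift (w - z) g)"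
    by (simp add: tf_shift_tf_shift scaleC_scaleC cis_mult)
  then show ?thesis
    by (simp add: cinner_scaleC_right cis_cnj)
qed

section \<open>Lattices and orthogonal Gabor systems\<close>

lemma is_lattice_0: "is_lattice \<Lambda> \<Longrightarrow> 0 \<in> \<Lambda>"
  unfolding is_lattice_def by (auto intro!: image_eqI[of _ _ 0])

lemma is_lattice_diff:
  fixes \<Lambda> :: "(real^'m) set"
  assumes "is_lattice \<Lambda>" "z \<in> \<Lambda>" "w \<in> \<Lambda>"
  shows "z - w \<in> \<Lambda>"
proof -
  obtain A :: "real^'m^'m" where A: "\<Lambda> = (\<lambda>k. A *v k) ` {k. \<forall>i. k $ i \<in> \<int>}"
    using assms(1) unfolding is_lattice_def by blast
  obtain k l where "z = A *v k" "w = A *v l" and int: "\<forall>i. k $ i \<in> \<int>" "\<forall>i. l $ i \<in> \<int>"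
    using assms(2,3) unfolding A by blast
  then have "z - w = A *v (k - l)"
    by (simp add: matrix_vector_mult_diff_distrib)
  with int show ?thesis
    unfolding A by (intro image_eqI[of _ _ "k - l"]) auto
qed

text \<open>Only \<open>h\<close> itself is compared with its shifts. On a lattice this amounts to
  pairwise orthogonality, since the inner product of two shifts depends, up to a phase, only on
  their difference.\<close>

definition gabor_orthogonal :: "'n::finite l2 \<Rightarrow> (real^('n + 'n)) set \<Rightarrow> bool" where
  "gabor_orthogonal h \<Lambda> \<longleftrightarrow> (\<forall>z\<in>\<Lambda>. z \<noteq> 0 \<longrightarrow> cinner_l2 h (tf_shift z h) = 0)"

lemma gabor_orthogonal_subset: "gabor_orthogonal h \<Lambda> \<Longrightarrow> \<Lambda>' \<subseteq> \<Lambda> \<Longrightarrow> gabor_orthogonal h \<Lambda>'"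
  by (auto simp: gabor_orthogonal_def)

text \<open>Interchanging \<pi>(z) and \<pi>(w) costs a phase, and \<pi>(w) preserves inner
  products. So the shifts of one window may all be used with the same lattice.\<close>

lemma gabor_orthogonal_tf_shift:
  assumes "gabor_orthogonal h \<Lambda>"
  shows "gabor_orthogonal (tf_shift w h) \<Lambda>"
  unfolding gabor_orthogonal_def tf_shift_commute[of _ w h]
  using assms by (auto simp: gabor_orthogonal_def cinner_scaleC_right)

lemma gabor_orthogonalD:
  assumes "gabor_orthogonal h \<Lambda>" "z - w \<in> \<Lambda>" "z \<noteq> w"
  shows "cinner_l2 (tf_shift w h) (tf_shift z h) = 0"
  using assms by (simp add: cinner_tf_shift_tf_shift gabor_orthogonal_def)

text \<open>The vector \<open>p\<close> is the orthogonal projection of \<open>f\<close> onto the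
  span of the finite family. Both \<open>inner f p\<close> and \<open>inner p p\<close> equal the
  sum of squares, so the claim is the nonnegativity of \<open>inner (f - p) (f - p)\<close>.\<close>

lemma bessel_inequality:
  assumes "finite A" and orth: "\<And>a b. a \<in> A \<Longrightarrow> b \<in> A \<Longrightarrow> a \<noteq> b \<Longrightarrow> cinner_l2 (e a) (e b) = 0"
    and norm: "\<And>a. a \<in> A \<Longrightarrow> norm (e a) = 1"
  shows "(\<Sum>a\<in>A. (cmod (cinner_l2 f (e a)))\<^sup>2) \<le> (norm f)\<^sup>2"
proof -
  define c where "c a = cinner_l2 f (e a)" for a
  define p where "p = (\<Sum>a\<in>A. c a *\<^sub>C e a)"
  let ?s = "\<Sum>a\<in>A. (cmod (c a))\<^sup>2"
  have sq: "c a * cnj (c a) = complex_of_real ((cmod (c a))\<^sup>2)" for a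
    by (simp only: complex_norm_square)
  have "inner f p = (\<Sum>a\<in>A. Re (cinner_l2 f (c a *\<^sub>C e a)))"
    by (simp add: p_def inner_sum_right Re_cinner)
  also have "\<dots> = ?s"
  proof (rule sum.cong)
    fix a
    have "cinner_l2 f (c a *\<^sub>C e a) = complex_of_real ((cmod (c a))\<^sup>2)"
      unfolding cinner_scaleC_right sq[symmetric] by (simp add: c_def mult.commute)
    then show "Re (cinner_l2 f (c a *\<^sub>C e a)) = (cmod (c a))\<^sup>2" by simp
  qed simp
  finally have fp: "inner f p = ?s" .
  have "inner p p = (\<Sum>a\<in>A. \<Sum>b\<in>A. Re (cinner_l2 (c b *\<^sub>C e b) (c a *\<^sub>C e a)))"
    by (simp add: p_def inner_sum_right inner_sum_left Re_cinner)
  also have "\<dots> = (\<Sum>a\<in>A. \<Sum>b\<in>A. if b = a then (cmod (c a))\<^sup>2 else 0)"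
  proof (intro sum.cong refl)
    fix a b assume "a \<in> A" "b \<in> A"
    moreover have "cinner_l2 (c a *\<^sub>C e a) (c a *\<^sub>C e a) = complex_of_real ((cmod (c a))\<^sup>2)"
      using norm[OF \<open>a \<in> A\<close>] by (simp add: cinner_self norm_scaleC)
    ultimately show "Re (cinner_l2 (c b *\<^sub>C e b) (c a *\<^sub>C e a)) = (if b = a then (cmod (c a))\<^sup>2 else 0)"
      using orth[of b a] by (cases "b = a") (simp_all add: cinner_scaleC_left cinner_scaleC_right)
  qed
  also have "\<dots> = ?s"
    using \<open>finite A\<close> by (intro sum.cong refl) (simp add: sum.delta)
  finally have pp: "inner p p = ?s" .
  have "0 \<le> inner (f - p) (f - p)" by simp
  also have "\<dots> = (norm f)\<^sup>2 - ?s"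
    using fp pp by (simp add: inner_diff_left inner_diff_right inner_commute[of p f] power2_norm_eq_inner)
  finally show ?thesis by (simp add: c_def)
qed

lemma gabor_orthogonal_imp_bessel:
  assumes "is_lattice \<Lambda>" "gabor_orthogonal h \<Lambda>" "norm h = 1"
  shows "bessel h \<Lambda>"
proof -
  let ?a = "\<lambda>f z. (cmod (cinner_l2 f (tf_shift z h)))\<^sup>2"
  have fin: "sum (?a f) A \<le> (norm f)\<^sup>2" if "finite A" "A \<subseteq> \<Lambda>" for A f
  proof (rule bessel_inequality[OF \<open>finite A\<close>])
    fix a b assume "a \<in> A" "b \<in> A" "a \<noteq> b"
    then show "cinner_l2 (tf_shift a h) (tf_shift b h) = 0"
      using that is_lattice_diff[OF assms(1), of b a] by (intro gabor_orthogonalD[OF assms(2)]) auto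
  qed (simp add: assms(3))
  have "?a f summable_on \<Lambda>" for f
    using fin by (intro nonneg_bdd_above_summable_on) (auto intro!: bdd_aboveI2)
  moreover from this have "infsum (?a f) \<Lambda> \<le> (norm f)\<^sup>2" for f
    using fin by (intro infsum_le_finite_sums) auto
  ultimately show ?thesis
    unfolding bessel_def by (intro exI[of _ 1]) auto
qed

text \<open>By orthonormality over the larger lattice \<open>\<Lambda>0\<close>, the only nonzero
  coefficient is the one at \<open>w = z\<close>, and this index occurs only if
  \<open>z \<in> \<Lambda>\<close>. The sublattice thus acts as a switch.\<close>

lemma has_sum_frame_op_tf_shift:
  assumes lat: "is_lattice \<Lambda>0" and orth: "gabor_orthogonal g \<Lambda>0" and norm: "norm g = 1"
    and "\<Lambda> \<subseteq> \<Lambda>0" "z \<in> \<Lambda>0"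
  shows "((\<lambda>w. cinner_l2 (tf_shift z g) (tf_shift w g) *\<^sub>C tf_shift w h) has_sum
    (if z \<in> \<Lambda> then tf_shift z h else 0)) \<Lambda>"
proof -
  have "cinner_l2 (tf_shift z g) (tf_shift w g) = (if w = z then 1 else 0)" if "w \<in> \<Lambda>" for w
    using gabor_orthogonalD[OF orth, of w z] is_lattice_diff[OF lat, of w z] norm assms that
    by (auto simp: cinner_self)
  then have "((\<lambda>w. cinner_l2 (tf_shift z g) (tf_shift w g) *\<^sub>C tf_shift w h) has_sum
      (if z \<in> \<Lambda> then tf_shift z h else 0)) \<Lambda> \<longleftrightarrow>
    ((\<lambda>w. tf_shift w h) has_sum (if z \<in> \<Lambda> then tf_shift z h else 0)) (\<Lambda> \<inter> {z})"
    by (intro has_sum_cong_neutral) (auto simp: cinner_self norm)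
  also have "\<dots>"
    by (intro has_sum_finiteI) auto
  finally show ?thesis .
qed

text \<open>Adding \<open>g + g\<close> to the argument shifts the value by \<open>h + h\<close>,
  which keeps it away from 0 even when \<open>z \<notin> \<Lambda>\<close>.\<close>

lemma frame_op_tf_shift_add:
  assumes "is_lattice \<Lambda>0" "gabor_orthogonal g \<Lambda>0" "norm g = 1"
    and "is_lattice \<Lambda>" "\<Lambda> \<subseteq> \<Lambda>0" "z \<in> \<Lambda>0"
  shows "frame_op \<Lambda> g h (tf_shift z g + (g + g)) = (if z \<in> \<Lambda> then tf_shift z h else 0) + (h + h)"
    and "frame_op \<Lambda> g h g = h"
proof -
  note shift = has_sum_frame_op_tf_shift[OF assms(1-3,5), where h = h]
  have g: "((\<lambda>w. cinner_l2 g (tf_shift w g) *\<^sub>C tf_shift w h) has_sum h) \<Lambda>"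
    using shift[of 0] is_lattice_0[OF assms(1)] is_lattice_0[OF assms(4)] by simp
  then show "frame_op \<Lambda> g h g = h"
    unfolding frame_op_def by (rule infsumI)
  show "frame_op \<Lambda> g h (tf_shift z g + (g + g)) = (if z \<in> \<Lambda> then tf_shift z h else 0) + (h + h)"
    unfolding frame_op_def cinner_add_left scaleC_add_left
    by (rule infsumI, rule has_sum_add[OF shift[OF assms(6)] has_sum_add[OF g g]])
qed

text \<open>The map \<open>\<kappa>\<close> is the identity for a linear \<open>F\<close> and
  complex conjugation for an antilinear one, so both cases are treated at once.\<close>

locale gabor_covariance =
  fixes F :: "'n::finite l2 \<Rightarrow> 'n l2" and T :: "real^('n + 'n)^('n + 'n)" and \<kappa> :: "complex \<Rightarrow> complex"
  assumes invertible_T: "invertible T"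
    and conjugation: "\<kappa> = id \<or> \<kappa> = cnj"
    and F_add: "F (f + g) = F f + F g"
    and F_scaleC: "F (c *\<^sub>C f) = \<kappa> c *\<^sub>C F f"
    and bij_F: "bij F"
    and covariant: "is_lattice \<Lambda> \<Longrightarrow> bessel g \<Lambda> \<Longrightarrow> bessel h \<Lambda> \<Longrightarrow>
      F \<circ> frame_op \<Lambda> g h \<circ> inv F = frame_op ((\<lambda>z. T *v z) ` \<Lambda>) (F g) (F h)"
begin

lemma inj_T: "inj_on (\<lambda>z. T *v z) A"
  using inj_matrix_vector_mult[OF invertible_T] by (rule inj_on_subset) simp

lemma F_0 [simp]: "F 0 = 0"
  using F_add[of 0 0] by simp

lemma F_eq_0_iff [simp]: "F f = 0 \<longleftrightarrow> f = 0"
  using bij_is_inj[OF bij_F] F_0 by (metis injD)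

text \<open>
  A value of \<^const>\<open>frame_op\<close> that is nonzero is not the junk value of a divergent sum, so no
  completeness of \<^typ>\<open>'n l2\<close> is needed here. In the second lemma, the summand \<open>h + h\<close> is there to
  make the value nonzero.
\<close>

lemma has_sum_F:
  assumes "is_lattice \<Lambda>" "bessel g \<Lambda>" "bessel h \<Lambda>" and "frame_op \<Lambda> g h f \<noteq> 0"
  shows "((\<lambda>w. cinner_l2 (F f) (tf_shift (T *v w) (F g)) *\<^sub>C tf_shift (T *v w) (F h)) has_sum
    F (frame_op \<Lambda> g h f)) \<Lambda>"
proof -
  let ?t = "\<lambda>w. cinner_l2 (F f) (tf_shift w (F g)) *\<^sub>C tf_shift w (F h)"
  have "F (frame_op \<Lambda> g h f) = frame_op ((\<lambda>z. T *v z) ` \<Lambda>) (F g) (F h) (F f)"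
    using fun_cong[OF covariant[OF assms(1-3)], of "F f"] by (simp add: inv_f_f[OF bij_is_inj[OF bij_F]])
  then have eq: "F (frame_op \<Lambda> g h f) = infsum ?t ((\<lambda>z. T *v z) ` \<Lambda>)"
    by (simp add: frame_op_def)
  moreover have "F (frame_op \<Lambda> g h f) \<noteq> 0"
    using assms(4) by simp
  ultimately have "?t summable_on (\<lambda>z. T *v z) ` \<Lambda>"
    using infsum_not_exists[of ?t "(\<lambda>z. T *v z) ` \<Lambda>"] by argo
  then have "(?t has_sum F (frame_op \<Lambda> g h f)) ((\<lambda>z. T *v z) ` \<Lambda>)"
    by (simp add: eq)
  then show ?thesis
    by (simp add: has_sum_reindex[OF inj_T] comp_def)
qed

lemma has_sum_F_tf_shift:
  assumes "is_lattice \<Lambda>0" "gabor_orthogonal g \<Lambda>0" "gabor_orthogonal h \<Lambda>0" "norm g = 1" "norm h = 1"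
    and "is_lattice \<Lambda>" "\<Lambda> \<subseteq> \<Lambda>0" "z \<in> \<Lambda>0"
  shows "((\<lambda>w. cinner_l2 (F (tf_shift z g)) (tf_shift (T *v w) (F g)) *\<^sub>C tf_shift (T *v w) (F h))
    has_sum (if z \<in> \<Lambda> then F (tf_shift z h) else 0)) \<Lambda>"
proof -
  note op = frame_op_tf_shift_add[OF assms(1,2,4,6,7,8), of h]
  have bessel: "bessel g \<Lambda>" "bessel h \<Lambda>"
    using assms by (auto intro: gabor_orthogonal_imp_bessel gabor_orthogonal_subset)
  define a where "a w = cinner_l2 (F (tf_shift z g)) (tf_shift (T *v w) (F g)) *\<^sub>C tf_shift (T *v w) (F h)" for w
  define b where "b w = cinner_l2 (F g) (tf_shift (T *v w) (F g)) *\<^sub>C tf_shift (T *v w) (F h)" for w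
  have "h \<noteq> 0" using assms(5) by auto
  \<comment> \<open>If the sum vanished, \<open>2 *\<^sub>R h\<close>, of norm 2, would have the
    same norm as \<open>tf_shift z h\<close> or 0, which is at most 1.\<close>
  have "(if z \<in> \<Lambda> then tf_shift z h else 0) + (h + h) \<noteq> 0"
  proof
    assume "(if z \<in> \<Lambda> then tf_shift z h else 0) + (h + h) = 0"
    then have "norm (2 *\<^sub>R h) = norm (if z \<in> \<Lambda> then tf_shift z h else 0)"
      unfolding scaleR_2 by (metis add.commute add_eq_0_iff norm_minus_cancel)
    then show False using assms(5) by (auto split: if_splits)
  qed
  then have "((\<lambda>w. cinner_l2 (F (tf_shift z g + (g + g))) (tf_shift (T *v w) (F g)) *\<^sub>C
      tf_shift (T *v w) (F h)) has_sum F ((if z \<in> \<Lambda> then tf_shift z h else 0) + (h + h))) \<Lambda>"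
    using has_sum_F[OF assms(6) bessel, of "tf_shift z g + (g + g)"] by (simp add: op)
  then have sum: "((\<lambda>w. a w + (b w + b w)) has_sum (if z \<in> \<Lambda> then F (tf_shift z h) else 0) + (F h + F h)) \<Lambda>"
    unfolding F_add cinner_add_left scaleC_add_left a_def b_def if_distrib[of F] F_0 .
  \<comment> \<open>The auxiliary summand is now removed by subtracting the expansion of
    \<open>F h\<close> twice.\<close>
  have b: "((\<lambda>w. - b w) has_sum - F h) \<Lambda>"
    using has_sum_F[OF assms(6) bessel, of g] \<open>h \<noteq> 0\<close> by (simp add: op has_sum_uminus b_def)
  have "x + (y + y) + (- y + - y) = x" for x y :: "'n l2"
    by simp
  with has_sum_add[OF sum has_sum_add[OF b b]] show ?thesis
    by (simp add: a_def)
qed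

end

lemma position_minus: "position (- z) = - position z"
  and frequency_minus: "frequency (- z) = - frequency z"
  by (simp_all add: position_def frequency_def vec_eq_iff)

lemma symplectic_form_minus [simp]:
  "symplectic_form (- z) w = - symplectic_form z w"
  "symplectic_form z (- w) = - symplectic_form z w"
  by (simp_all add: symplectic_form_def position_minus frequency_minus)

lemma cis_eq_imp_diff_in_Ints:
  assumes "cis (2 * pi * x) = cis (2 * pi * y)"
  shows "x - y \<in> \<int>"
proof -
  have "sin (2 * pi * x) = sin (2 * pi * y) \<and> cos (2 * pi * x) = cos (2 * pi * y)"
    using assms by (simp add: complex_eq_iff)
  then obtain n :: int where "2 * pi * x = 2 * pi * y + 2 * pi * n"
    unfolding sin_cos_eq_iff by blast
  then have "2 * pi * (x - y) = 2 * pi * n"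
    by (simp add: algebra_simps)
  then show ?thesis by simp
qed

text \<open>
  The last condition says, without reference to a basis, that \<open>z\<close> is a primitive vector of \<open>\<Lambda>0\<close>.
\<close>

definition gabor_primitive ::
  "'n::finite l2 \<Rightarrow> (real^('n + 'n)) set \<Rightarrow> real^('n + 'n) \<Rightarrow> bool" where
  "gabor_primitive g \<Lambda>0 z \<longleftrightarrow> is_lattice \<Lambda>0 \<and> gabor_orthogonal g \<Lambda>0 \<and> z \<in> \<Lambda>0 \<and> z \<noteq> 0 \<and>
    (\<forall>w\<in>\<Lambda>0. w \<noteq> 0 \<longrightarrow> (\<exists>\<Lambda>. is_lattice \<Lambda> \<and> \<Lambda> \<subseteq> \<Lambda>0 \<and> w \<notin> \<Lambda>)) \<and>
    (\<forall>w\<in>\<Lambda>0. w \<noteq> z \<longrightarrow> w \<noteq> - z \<longrightarrow> (\<exists>\<Lambda>. is_lattice \<Lambda> \<and> \<Lambda> \<subseteq> \<Lambda>0 \<and> w \<in> \<Lambda> \<and> z \<notin> \<Lambda>))"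

section \<open>Action of the operator on shifts by primitive vectors\<close>

context gabor_covariance
begin

text \<open>The case \<open>h = g\<close>, \<open>z = 0\<close> expands \<open>F g\<close> over
  every sublattice. Pairing with \<open>F g\<close> shows that the squared coefficients
  \<open>a\<close> have the same sum \<open>s\<close> over all sublattices of
  \<open>\<Lambda>0\<close>.\<close>

lemma F_orthonormal:
  assumes prim: "gabor_primitive g \<Lambda>0 z" and norm: "norm g = 1"
  shows "norm (F g) = 1" and "gabor_orthogonal (F g) ((\<lambda>z. T *v z) ` \<Lambda>0)"
proof -
  define a where "a w = (cmod (cinner_l2 (F g) (tf_shift (T *v w) (F g))))\<^sup>2" for w
  define s where "s = (norm (F g))\<^sup>2"
  have lat: "is_lattice \<Lambda>0" and orth: "gabor_orthogonal g \<Lambda>0"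
    using prim by (auto simp: gabor_primitive_def)
  have sum: "(a has_sum s) \<Lambda>" if "is_lattice \<Lambda>" "\<Lambda> \<subseteq> \<Lambda>0" for \<Lambda>
  proof -
    have "((\<lambda>w. cinner_l2 (F g) (tf_shift (T *v w) (F g)) *\<^sub>C tf_shift (T *v w) (F g)) has_sum F g) \<Lambda>"
      using has_sum_F_tf_shift[OF lat orth orth norm norm that is_lattice_0[OF lat]]
        is_lattice_0[OF that(1)] by simp
    from has_sum_Re[OF has_sum_bounded_linear[OF bounded_linear_cinner_left this, of "F g"]]
    have "((\<lambda>w. Re (cinner_l2 (F g) (tf_shift (T *v w) (F g)) * cinner_l2 (tf_shift (T *v w) (F g)) (F g)))
        has_sum s) \<Lambda>"
      by (simp only: cinner_scaleC_left cinner_self Re_complex_of_real s_def)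
    moreover have "Re (cinner_l2 (F g) x * cinner_l2 x (F g)) = (cmod (cinner_l2 (F g) x))\<^sup>2" for x
      unfolding cinner_commute[of x "F g"] complex_norm_square[symmetric] by (rule Re_complex_of_real)
    ultimately show ?thesis
      by (simp add: a_def[abs_def])
  qed
  have zero: "a w = 0" if w: "w \<in> \<Lambda>0" "w \<noteq> 0" for w
  proof -
    obtain \<Lambda> where \<Lambda>: "is_lattice \<Lambda>" "\<Lambda> \<subseteq> \<Lambda>0" "w \<notin> \<Lambda>"
      using prim w unfolding gabor_primitive_def by meson
    \<comment> \<open>A sublattice that omits \<open>w\<close> already exhausts the sum
      \<open>s\<close>, so adjoining the nonnegative term \<open>a w\<close> leaves no room for a
      positive value.\<close>
    have "(a has_sum s + a w) (\<Lambda> \<union> {w})"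
      using \<Lambda> by (intro has_sum_Un_disjoint sum has_sum_finiteI) auto
    then have "s + a w \<le> s"
      by (rule has_sum_mono2[OF _ sum[OF lat order_refl]]) (use \<Lambda> w in \<open>auto simp: a_def\<close>)
    then show ?thesis by (simp add: a_def)
  qed
  have "(a has_sum s) \<Lambda>0 \<longleftrightarrow> (a has_sum s) {0}"
    using is_lattice_0[OF lat] zero by (intro has_sum_cong_neutral) auto
  then have "(a has_sum s) {0}"
    using sum[OF lat order_refl] by simp
  moreover have "(a has_sum a 0) {0}"
    by (intro has_sum_finiteI) auto
  ultimately have "s = a 0"
    by (rule has_sum_unique)
  \<comment> \<open>The term at 0 is the square of \<open>s\<close>, so \<open>s\<close> is 0 or 1;
    it is not 0 because \<open>F\<close> is injective and \<open>g\<close> is nonzero.\<close>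
  also have "\<dots> = s\<^sup>2"
    by (simp add: a_def s_def cinner_self norm_power)
  finally have "s = 1"
    using norm by (auto simp: power2_eq_square s_def)
  then show "norm (F g) = 1"
    using power2_eq_iff_nonneg[of "norm (F g)" 1] by (simp add: s_def)
  show "gabor_orthogonal (F g) ((\<lambda>z. T *v z) ` \<Lambda>0)"
    using zero by (auto simp: gabor_orthogonal_def a_def) (metis matrix_vector_mult_0_right)
qed

text \<open>The vectors z and -z generate the same subgroup, so sublattices cannot tell them apart;
  every other lattice point is eliminated by a sublattice that contains it but not
  \<open>z\<close>.\<close>

lemma F_tf_shift_two_terms:
  assumes prim: "gabor_primitive g \<Lambda>0 z" and norm: "norm g = 1"
  obtains \<alpha> \<beta> where "\<And>w. F (tf_shift z (tf_shift w g)) =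
    \<alpha> *\<^sub>C tf_shift (T *v z) (F (tf_shift w g)) + \<beta> *\<^sub>C tf_shift (- (T *v z)) (F (tf_shift w g))"
proof -
  define c where "c w = cinner_l2 (F (tf_shift z g)) (tf_shift (T *v w) (F g))" for w
  have lat: "is_lattice \<Lambda>0" and orth: "gabor_orthogonal g \<Lambda>0" and z: "z \<in> \<Lambda>0" "z \<noteq> 0"
    using prim by (auto simp: gabor_primitive_def)
  note F_orth = F_orthonormal[OF prim norm]
  have zero: "c w = 0" if w: "w \<in> \<Lambda>0" "w \<noteq> z" "w \<noteq> - z" for w
  proof -
    obtain \<Lambda> where \<Lambda>: "is_lattice \<Lambda>" "\<Lambda> \<subseteq> \<Lambda>0" "w \<in> \<Lambda>" "z \<notin> \<Lambda>"
      using prim w unfolding gabor_primitive_def by meson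
    have "((\<lambda>v. c v *\<^sub>C tf_shift (T *v v) (F g)) has_sum 0) \<Lambda>"
      using has_sum_F_tf_shift[OF lat orth orth norm norm \<Lambda>(1,2) z(1)] \<Lambda>(4) by (simp add: c_def)
    \<comment> \<open>Since \<open>z\<close> is missing from the sublattice, the whole sum is 0;
      pairing it with the shift of \<open>F g\<close> by \<open>T *v w\<close> isolates
      \<open>c w\<close> by the orthonormality just proved.\<close>
    from has_sum_bounded_linear[OF bounded_linear_cinner_left this, of "tf_shift (T *v w) (F g)"]
    have "((\<lambda>v. c v * cinner_l2 (tf_shift (T *v v) (F g)) (tf_shift (T *v w) (F g))) has_sum 0) \<Lambda>"
      by (simp add: cinner_scaleC_left)
    also have "?this \<longleftrightarrow> (c has_sum 0) {w}"
    proof (rule has_sum_cong_neutral)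
      fix v assume v: "v \<in> \<Lambda> - {w}"
      then have "T *v w - T *v v \<in> (\<lambda>z. T *v z) ` \<Lambda>0"
        using is_lattice_diff[OF lat w(1), of v] \<Lambda>(2)
        by (auto simp flip: matrix_vector_mult_diff_distrib)
      moreover have "T *v w \<noteq> T *v v"
        using v inj_onD[OF inj_T[of UNIV], of w v] by auto
      ultimately show "c v * cinner_l2 (tf_shift (T *v v) (F g)) (tf_shift (T *v w) (F g)) = 0"
        using gabor_orthogonalD[OF F_orth(2)] by simp
    qed (use \<Lambda>(3) in \<open>auto simp: cinner_self F_orth(1)\<close>)
    finally have "(c has_sum 0) {w}" .
    moreover have "(c has_sum c w) {w}"
      by (intro has_sum_finiteI) auto
    ultimately show "c w = 0"
      by (rule has_sum_unique[symmetric])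
  qed
  have "F (tf_shift z (tf_shift w g)) = c z *\<^sub>C tf_shift (T *v z) (F (tf_shift w g)) +
      c (- z) *\<^sub>C tf_shift (- (T *v z)) (F (tf_shift w g))" for w
  proof -
    let ?t = "\<lambda>v. c v *\<^sub>C tf_shift (T *v v) (F (tf_shift w g))"
    have neg: "T *v (- z) = - (T *v z)"
      using matrix_vector_mult_diff_distrib[of T 0 z] by simp
    have "z \<noteq> - z"
      using z(2) by (metis add_cancel_right_right add.right_inverse scaleR_2 scaleR_eq_0_iff zero_neq_numeral)
    have "- z \<in> \<Lambda>0"
      using is_lattice_diff[OF lat is_lattice_0[OF lat] z(1)] by simp
    \<comment> \<open>The window \<open>h\<close> is now a shift of \<open>g\<close>, while the
      coefficients still involve \<open>g\<close> alone. Hence \<alpha> and \<beta> do not depend on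
      \<open>w\<close>.\<close>
    have "(?t has_sum F (tf_shift z (tf_shift w g))) \<Lambda>0"
      using has_sum_F_tf_shift[OF lat orth gabor_orthogonal_tf_shift[OF orth, of w] norm _ lat order_refl z(1)] z(1) norm
      by (simp add: c_def)
    also have "?this \<longleftrightarrow> (?t has_sum F (tf_shift z (tf_shift w g))) {z, - z}"
      using zero z(1) \<open>- z \<in> \<Lambda>0\<close> by (intro has_sum_cong_neutral) auto
    finally have "(?t has_sum F (tf_shift z (tf_shift w g))) {z, - z}" .
    moreover have "(?t has_sum ?t z + ?t (- z)) {z, - z}"
      using \<open>z \<noteq> - z\<close> by (intro has_sum_finiteI) auto
    ultimately have "F (tf_shift z (tf_shift w g)) = ?t z + ?t (- z)"
      by (rule has_sum_unique)
    then show ?thesis by (simp add: neg)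
  qed
  then show thesis by (rule that)
qed

text \<open>
  Squaring the two-term formula produces a multiple of \<open>F g\<close> with coefficient \<open>2 \<alpha> \<beta>\<close>, which the
  two-term formula for \<open>2 z\<close> does not allow.
\<close>

lemma F_tf_shift_intertwine:
  assumes prim: "gabor_primitive g \<Lambda>0 z" "gabor_primitive g \<Lambda>1 (z + z)" and norm: "norm g = 1"
  obtains a Z where "a \<noteq> 0" "Z = T *v z \<or> Z = - (T *v z)"
    "\<And>w. F (tf_shift z (tf_shift w g)) = a *\<^sub>C tf_shift Z (F (tf_shift w g))"
proof -
  define Z where "Z = T *v z"
  let ?G = "F g"
  obtain \<alpha> \<beta> where F1: "\<And>w. F (tf_shift z (tf_shift w g)) =
      \<alpha> *\<^sub>C tf_shift Z (F (tf_shift w g)) + \<beta> *\<^sub>C tf_shift (- Z) (F (tf_shift w g))"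
    using F_tf_shift_two_terms[OF prim(1) norm] unfolding Z_def by blast
  obtain \<alpha>' \<beta>' where F2: "\<And>w. F (tf_shift (z + z) (tf_shift w g)) =
      \<alpha>' *\<^sub>C tf_shift (T *v (z + z)) (F (tf_shift w g)) + \<beta>' *\<^sub>C tf_shift (- (T *v (z + z))) (F (tf_shift w g))"
    using F_tf_shift_two_terms[OF prim(2) norm] by blast
  note F_orth = F_orthonormal[OF prim(1) norm]
  have lat: "is_lattice \<Lambda>0" and z: "z \<in> \<Lambda>0" "z \<noteq> 0"
    using prim by (auto simp: gabor_primitive_def)
  have "z + z \<noteq> 0"
    using prim(2) by (simp add: gabor_primitive_def)
  have mz: "- z \<in> \<Lambda>0"
    using is_lattice_diff[OF lat is_lattice_0[OF lat] z(1)] by simp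
  have "z + z \<in> \<Lambda>0" "- z - z \<in> \<Lambda>0"
    using is_lattice_diff[OF lat z(1) mz] is_lattice_diff[OF lat mz z(1)] by simp_all
  then have mem: "Z + Z \<in> (\<lambda>z. T *v z) ` \<Lambda>0" "- Z - Z \<in> (\<lambda>z. T *v z) ` \<Lambda>0"
  proof -
    have "T *v (- z) = - (T *v z)"
      using matrix_vector_mult_diff_distrib[of T 0 z] by simp
    then have "Z + Z = T *v (z + z)" "- Z - Z = T *v (- z - z)"
      by (simp_all only: Z_def matrix_vector_right_distrib matrix_vector_mult_diff_distrib)
    with \<open>z + z \<in> \<Lambda>0\<close> \<open>- z - z \<in> \<Lambda>0\<close> show "Z + Z \<in> (\<lambda>z. T *v z) ` \<Lambda>0" "- Z - Z \<in> (\<lambda>z. T *v z) ` \<Lambda>0"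
      by auto
  qed
  have "Z + Z = T *v (z + z)"
    by (simp only: Z_def matrix_vector_right_distrib)
  then have ne: "Z + Z \<noteq> 0" "- Z - Z \<noteq> 0"
    using \<open>z + z \<noteq> 0\<close> inj_onD[OF inj_T[of UNIV], of "z + z" 0]
    by (auto simp: minus_diff_commute neg_eq_iff_add_eq_0 simp flip: minus_add_distrib)
  have inner: "cinner_l2 (tf_shift (Z + Z) ?G) ?G = 0" "cinner_l2 (tf_shift (- Z - Z) ?G) ?G = 0"
    using F_orth(2) mem ne cinner_commute[of _ ?G] unfolding gabor_orthogonal_def
    by (metis complex_cnj_zero)+
  have "\<alpha> * \<beta> = 0"
  proof -
    have "- (Z + Z) = - Z - Z"
      by simp
    with F2[of 0] have "F (tf_shift (z + z) g) = \<alpha>' *\<^sub>C tf_shift (Z + Z) ?G + \<beta>' *\<^sub>C tf_shift (- Z - Z) ?G"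
      by (simp only: tf_shift_0 \<open>Z + Z = T *v (z + z)\<close>[symmetric])
    then have "cinner_l2 (F (tf_shift z (tf_shift z g))) ?G = 0"
      by (simp only: tf_shift_tf_shift F_scaleC cinner_scaleC_left cinner_add_left inner
        mult_zero_right add_0_right)
    \<comment> \<open>The two mixed products are multiples of \<open>F g\<close> with the same
      phase, so they add up instead of cancelling; the remaining terms are orthogonal to
      \<open>F g\<close>.\<close>
    moreover have "F (tf_shift z (tf_shift z g)) =
      \<alpha> *\<^sub>C tf_shift Z (\<alpha> *\<^sub>C tf_shift Z ?G + \<beta> *\<^sub>C tf_shift (- Z) ?G) +
      \<beta> *\<^sub>C tf_shift (- Z) (\<alpha> *\<^sub>C tf_shift Z ?G + \<beta> *\<^sub>C tf_shift (- Z) ?G)"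
      using F1[of z] F1[of 0] by simp
    ultimately show ?thesis
      using inner F_orth(1)
      by (simp add: tf_shift_add tf_shift_scaleC tf_shift_tf_shift scaleC_add_right scaleC_scaleC
        cinner_add_left cinner_scaleC_left cinner_self position_minus frequency_minus)
  qed
  have "F (tf_shift z (tf_shift 0 g)) \<noteq> 0"
    using norm by auto
  then have "\<alpha> \<noteq> 0 \<or> \<beta> \<noteq> 0"
    using F1[of 0] by auto
  with \<open>\<alpha> * \<beta> = 0\<close> consider "\<alpha> \<noteq> 0" "\<beta> = 0" | "\<alpha> = 0" "\<beta> \<noteq> 0"
    by auto
  then show thesis
  proof cases
    case 1
    then show thesis
      by (intro that[of \<alpha> Z]) (use F1 in \<open>auto simp: Z_def\<close>)
  next
    case 2
    then show thesis
      by (intro that[of \<beta> "- Z"]) (use F1 in \<open>auto simp: Z_def\<close>)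
  qed
qed

text \<open>Moving both shifts through \<open>F\<close> in either order gives multiples of one
  nonzero vector \<open>x\<close>. Comparing the two commutation phases, the one inside
  \<open>F\<close> being subject to \<open>\<kappa>\<close>, determines the forms up to sign and up
  to integers.\<close>

lemma symplectic_form_T_mod_1:
  assumes "gabor_primitive g \<Lambda>0 z" "gabor_primitive g \<Lambda>1 (z + z)"
    and "gabor_primitive g \<Lambda>2 w" "gabor_primitive g \<Lambda>3 (w + w)" and norm: "norm g = 1"
  shows "symplectic_form (T *v z) (T *v w) - symplectic_form z w \<in> \<int> \<or>
    symplectic_form (T *v z) (T *v w) + symplectic_form z w \<in> \<int>"
proof -
  obtain a Z where a: "a \<noteq> 0" and Z: "Z = T *v z \<or> Z = - (T *v z)"
    and Fz: "\<And>u. F (tf_shift z (tf_shift u g)) = a *\<^sub>C tf_shift Z (F (tf_shift u g))"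
    using F_tf_shift_intertwine[OF assms(1,2) norm] by blast
  obtain b W where b: "b \<noteq> 0" and W: "W = T *v w \<or> W = - (T *v w)"
    and Fw: "\<And>u. F (tf_shift w (tf_shift u g)) = b *\<^sub>C tf_shift W (F (tf_shift u g))"
    using F_tf_shift_intertwine[OF assms(3,4) norm] by blast
  define x where "x = (a * b) *\<^sub>C tf_shift W (tf_shift Z (F g))"
  have "x \<noteq> 0"
    using a b norm by (auto simp: x_def)
  have zw: "F (tf_shift z (tf_shift w g)) = cis (- 2 * pi * symplectic_form Z W) *\<^sub>C x"
    using Fz[of w] Fw[of 0] tf_shift_commute[of Z W "F g"]
    by (simp add: x_def tf_shift_scaleC scaleC_scaleC mult_ac)
  have wz: "F (tf_shift w (tf_shift z g)) = x"
    using Fw[of z] Fz[of 0] by (simp add: x_def tf_shift_scaleC scaleC_scaleC mult_ac)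
  have "F (tf_shift z (tf_shift w g)) = \<kappa> (cis (- 2 * pi * symplectic_form z w)) *\<^sub>C x"
    by (simp only: tf_shift_commute[of z w g] F_scaleC wz)
  with zw \<open>x \<noteq> 0\<close> have "cis (- 2 * pi * symplectic_form Z W) = \<kappa> (cis (- 2 * pi * symplectic_form z w))"
    by (intro scaleC_cancel_right[of _ x]) simp
  with conjugation have "cis (2 * pi * (- symplectic_form Z W)) = cis (2 * pi * (- symplectic_form z w)) \<or>
      cis (2 * pi * (- symplectic_form Z W)) = cis (2 * pi * symplectic_form z w)"
    by (auto simp: cis_cnj)
  then have "- symplectic_form Z W - - symplectic_form z w \<in> \<int> \<or>
      - symplectic_form Z W - symplectic_form z w \<in> \<int>"
    using cis_eq_imp_diff_in_Ints by blast
  then have "symplectic_form Z W - symplectic_form z w \<in> \<int> \<or> symplectic_form Z W + symplectic_form z w \<in> \<int>"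
    using minus_in_Ints_iff[of "symplectic_form Z W - symplectic_form z w"]
      minus_in_Ints_iff[of "symplectic_form Z W + symplectic_form z w"]
    by (simp add: algebra_simps)
  \<comment> \<open>Passing from \<open>Z\<close>, \<open>W\<close> to \<open>T *v z\<close>,
    \<open>T *v w\<close> changes at most the sign of the form, which at worst exchanges the two
    alternatives.\<close>
  then show ?thesis
    using Z W Ints_minus[of "symplectic_form Z W - symplectic_form z w"]
      Ints_minus[of "symplectic_form Z W + symplectic_form z w"]
    by (auto simp: add.commute)
qed

end

section \<open>The cube window\<close>

text \<open>Fubini for a product of functions of single coordinates: Lebesgue measure is the image
  of the product measure under the coordinate map.\<close>

lemma integral_lborel_prod:
  fixes f :: "'a::euclidean_space \<Rightarrow> real \<Rightarrow> 'b::{real_normed_field,banach,second_countable_topology}"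
  assumes int: "\<And>b. b \<in> Basis \<Longrightarrow> integrable lborel (f b)"
  shows "(\<integral>x. (\<Prod>b\<in>Basis. f b (x \<bullet> b)) \<partial>lborel) = (\<Prod>b\<in>Basis. \<integral>x. f b x \<partial>lborel)"
proof -
  interpret product_sigma_finite "\<lambda>_::'a. lborel :: real measure"
    by standard
  have [measurable]: "f b \<in> borel_measurable borel" if "b \<in> Basis" for b
    using int[OF that] by simp
  have "(\<integral>x. (\<Prod>b\<in>Basis. f b (x \<bullet> b)) \<partial>lborel) =
      (\<integral>y. (\<Prod>b\<in>Basis. f b ((\<Sum>b\<in>Basis. y b *\<^sub>R b) \<bullet> b)) \<partial>Pi\<^sub>M Basis (\<lambda>b. lborel))"
    by (subst lborel_eq) (subst integral_distr; simp)
  also have "\<dots> = (\<integral>y. (\<Prod>b\<in>Basis. f b (y b)) \<partial>Pi\<^sub>M Basis (\<lambda>b. lborel))"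
    by (simp cong: prod.cong)
  also have "\<dots> = (\<Prod>b\<in>Basis. \<integral>x. f b x \<partial>lborel)"
    using int by (intro product_integral_prod) auto
  finally show ?thesis .
qed

text \<open>The antiderivative \<open>exp (c * t) / c\<close> takes equal values at 0 and 1 when
  \<open>k\<close> is a nonzero integer.\<close>

lemma
  fixes k :: real
  shows integrable_cis_unit_interval: "integrable lborel (\<lambda>t::real. indicator {0..1} t *\<^sub>R cis (2 * pi * k * t))"
    and integral_cis_unit_interval: "k \<in> \<int> \<Longrightarrow> k \<noteq> 0 \<Longrightarrow>
      (\<integral>t. indicator {0..1} t *\<^sub>R cis (2 * pi * k * t) \<partial>lborel) = 0"
proof -
  have cont: "continuous_on {0..1} (\<lambda>t::real. cis (2 * pi * k * t))"
    by (intro continuous_intros)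
  then show "integrable lborel (\<lambda>t::real. indicator {0..1} t *\<^sub>R cis (2 * pi * k * t))"
    using borel_integrable_compact[OF compact_Icc] by (auto simp: set_integrable_def)
  assume k: "k \<in> \<int>" "k \<noteq> 0"
  define c where "c = complex_of_real (2 * pi * k) * \<i>"
  have "c \<noteq> 0" using k by (simp add: c_def)
  have cis: "cis (2 * pi * k * t) = exp (c * of_real t)" for t
    by (simp add: cis_conv_exp c_def mult_ac)
  have "((\<lambda>t. exp (c * of_real t) / c) has_vector_derivative cis (2 * pi * k * t)) (at t within {0..1})" for t
  proof -
    have "((\<lambda>z. exp (c * z) / c) has_field_derivative exp (c * of_real t)) (at (of_real t))"
      using \<open>c \<noteq> 0\<close> by (auto intro!: derivative_eq_intros)
    from has_vector_derivative_real_field[OF this] show ?thesis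
      by (simp add: cis has_vector_derivative_at_within)
  qed
  then have "(\<integral>t. indicator {0..1} t *\<^sub>R cis (2 * pi * k * t) \<partial>lborel) =
      exp (c * of_real 1) / c - exp (c * of_real 0) / c"
    by (intro integral_FTC_Icc cont) auto
  also have "exp (c * of_real 1) = exp (c * of_real 0)"
    using cis[of 1] cis_multiple_2pi[OF k(1)] by simp
  finally show "(\<integral>t. indicator {0..1} t *\<^sub>R cis (2 * pi * k * t) \<partial>lborel) = 0"
    by simp
qed

text \<open>Here \<open>1\<close> is the vector all of whose entries are 1.\<close>

lift_definition cube_window :: "'n::finite l2" is "indicator (cbox 0 1)"
proof -
  have "(\<lambda>x. (cmod (indicator (cbox 0 1) x))\<^sup>2) = (indicator (cbox 0 1) :: real^'n \<Rightarrow> real)"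
    by (auto simp: fun_eq_iff indicator_def)
  then show "square_integrable (indicator (cbox 0 1) :: real^'n \<Rightarrow> complex) \<and>
      square_integrable (indicator (cbox 0 1) :: real^'n \<Rightarrow> complex) \<and>
      (AE x in lborel. indicator (cbox 0 1 :: (real^'n) set) x = (indicator (cbox 0 1) x :: complex))"
    using emeasure_lborel_cbox_finite[of "0 :: real^'n" 1]
    by (simp add: square_integrable_def integrable_indicator_iff)
qed

lemma norm_cube_window: "norm (cube_window :: 'n::finite l2) = 1"
proof -
  have sq: "indicator A x * cnj (indicator A x) = complex_of_real (indicator A x)" for A and x :: "real^'n"
    by (simp add: indicator_def)
  have "cinner_l2 (cube_window :: 'n l2) cube_window = (\<integral>x. complex_of_real (indicator (cbox 0 1 :: (real^'n) set) x) \<partial>lborel)"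
    by transfer (simp only: sq)
  also have "\<dots> = 1"
    by (simp add: content_cbox_cart interval_eq_empty_cart)
  finally have "(norm (cube_window :: 'n l2))\<^sup>2 = 1"
    unfolding cinner_self by (metis of_real_eq_1_iff)
  then show ?thesis
    using power2_eq_iff_nonneg[of "norm (cube_window :: 'n l2)" 1] by simp
qed

text \<open>In coordinate \<open>i\<close> the cube and its translate do not meet, so the integrand
  vanishes identically.\<close>

lemma cinner_cube_window_disjoint:
  assumes "1 < \<bar>position z $ i\<bar>"
  shows "cinner_l2 cube_window (tf_shift z cube_window) = 0"
  using assms
proof transfer
  fix z :: "real^('a + 'a)" and i
  assume i: "1 < \<bar>position z $ i\<bar>"
  have "indicator (cbox 0 1) x * cnj (cis (2 * pi * (x \<bullet> frequency z)) * indicator (cbox 0 1) (x - position z)) = 0"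
    for x :: "real^'a"
  proof (cases "x \<in> cbox 0 1 \<and> x - position z \<in> cbox 0 1")
    case True
    then have "0 \<le> x $ i \<and> x $ i \<le> 1" "0 \<le> x $ i - position z $ i \<and> x $ i - position z $ i \<le> 1"
      by (auto simp: mem_box_cart dest: spec[of _ i])
    with i show ?thesis by linarith
  qed auto
  then show "(\<integral>x. indicator (cbox 0 1) x *
      cnj (cis (2 * pi * (x \<bullet> frequency z)) * indicator (cbox 0 1) (x - position z)) \<partial>lborel) = 0"
    by (simp only: Bochner_Integration.integral_zero)
qed

text \<open>The integral factorizes over the coordinates, and the factor for \<open>i\<close>
  integrates a nontrivial character over full periods.\<close>

lemma cinner_cube_window_modulation:
  assumes "position z = 0" "frequency z $ i \<in> \<int>" "frequency z $ i \<noteq> 0"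
  shows "cinner_l2 cube_window (tf_shift z cube_window) = 0"
  using assms
proof transfer
  fix z :: "real^('a + 'a)" and i
  assume z: "position z = 0" "frequency z $ i \<in> \<int>" "frequency z $ i \<noteq> 0"
  \<comment> \<open>The sign comes from the complex conjugate in the second argument of the inner
    product.\<close>
  define k where "k = - frequency z"
  let ?f = "\<lambda>b t. indicator {0..1} t *\<^sub>R cis (2 * pi * (k \<bullet> b) * t)"
  have "indicator (cbox 0 1) x * cnj (cis (2 * pi * (x \<bullet> frequency z)) * indicator (cbox 0 1) (x - position z)) =
      (\<Prod>b\<in>Basis. ?f b (x \<bullet> b))" for x :: "real^'a"
  proof -
    have "(\<Prod>b\<in>Basis. ?f b (x \<bullet> b)) =
        (\<Prod>b\<in>Basis. indicator {0..1} (x \<bullet> b) :: complex) * (\<Prod>b\<in>Basis. cis (2 * pi * (k \<bullet> b) * (x \<bullet> b)))"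
      unfolding prod.distrib[symmetric] by (intro prod.cong refl) (simp add: indicator_def)
    also have "(\<Prod>b\<in>Basis. indicator {0..1} (x \<bullet> b) :: complex) = indicator (cbox 0 1) x"
    proof (cases "x \<in> cbox 0 1")
      case True
      then have "x \<bullet> b \<in> {0..1}" if "b \<in> Basis" for b
        using that by (auto simp: mem_box_cart Basis_vec_def inner_axis)
      then show ?thesis using True by simp
    next
      case False
      then obtain j where "x $ j \<notin> {0..1}"
        by (auto simp: mem_box_cart)
      then have "\<exists>b\<in>Basis. (indicator {0..1} (x \<bullet> b) :: complex) = 0"
        by (intro bexI[of _ "axis j 1"]) (auto simp: Basis_vec_def inner_axis indicator_def)
      then have "(\<Prod>b\<in>Basis. indicator {0..1} (x \<bullet> b) :: complex) = 0"
        by (intro prod_zero) auto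
      then show ?thesis using False by simp
    qed
    also have "(\<Prod>b\<in>Basis. cis (2 * pi * (k \<bullet> b) * (x \<bullet> b))) = cis (\<Sum>b\<in>Basis. 2 * pi * (k \<bullet> b) * (x \<bullet> b))"
      by (simp add: cis_conv_exp exp_sum sum_distrib_left)
    also have "(\<Sum>b\<in>Basis. 2 * pi * (k \<bullet> b) * (x \<bullet> b)) = - (2 * pi * (x \<bullet> frequency z))"
      using euclidean_inner[of x "frequency z"] by (simp add: k_def sum_distrib_left mult_ac sum_negf)
    finally show ?thesis
      using z(1) by (simp add: cis_cnj indicator_def)
  qed
  then have "(\<integral>x. indicator (cbox 0 1) x *
      cnj (cis (2 * pi * (x \<bullet> frequency z)) * indicator (cbox 0 1) (x - position z)) \<partial>lborel) =
      (\<integral>x. (\<Prod>b\<in>Basis. ?f b (x \<bullet> b)) \<partial>lborel)"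
    by (intro Bochner_Integration.integral_cong refl)
  also have "\<dots> = (\<Prod>b\<in>Basis. \<integral>t. ?f b t \<partial>lborel)"
    by (intro integral_lborel_prod integrable_cis_unit_interval)
  also have "\<dots> = 0"
  proof (rule prod_zero)
    show "\<exists>b\<in>Basis. (\<integral>t. ?f b t \<partial>lborel) = 0"
      using z by (intro bexI[of _ "axis i 1"] integral_cis_unit_interval)
        (auto simp: k_def inner_axis Basis_vec_def)
  qed simp
  finally show "(\<integral>x. indicator (cbox 0 1) x *
      cnj (cis (2 * pi * (x \<bullet> frequency z)) * indicator (cbox 0 1) (x - position z)) \<partial>lborel) = 0" .
qed

section \<open>Lattices with a prescribed primitive vector\<close>

text \<open>This is \<open>N\<close> times the identity with column \<open>q\<close> replaced by
  \<open>v\<close>. It serves both as a lattice basis containing a given vector and as an integer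
  matrix that cuts out a sublattice.\<close>

definition column_matrix :: "'m \<Rightarrow> real^'m \<Rightarrow> real \<Rightarrow> real^'m^'m" where
  "column_matrix q v N = (\<chi> r c. if c = q then v $ r else if r = c then N else 0)"

lemma column_matrix_mult:
  fixes q :: "'m::finite"
  shows "(column_matrix q v N *v m) $ r = v $ r * m $ q + (if r = q then 0 else N * m $ r)"
proof -
  have "(column_matrix q v N *v m) $ r =
      (\<Sum>c\<in>UNIV. (if c = q then v $ r * m $ q else 0) + (if c = r then if r = q then 0 else N * m $ r else 0))"
    unfolding column_matrix_def matrix_vector_mult_def vec_lambda_beta
    by (intro sum.cong refl) auto
  then show ?thesis
    by (simp add: sum.distrib)
qed

lemma column_matrix_mult_axis: "column_matrix q v N *v axis q 1 = v"
  by (simp add: vec_eq_iff column_matrix_mult axis_def)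

lemma invertible_column_matrix:
  assumes "v $ q \<noteq> 0" "N \<noteq> 0"
  shows "invertible (column_matrix q v N)"
proof -
  have "m = 0" if "column_matrix q v N *v m = 0" for m
  proof -
    have *: "v $ r * m $ q + (if r = q then 0 else N * m $ r) = 0" for r
      using that by (metis column_matrix_mult zero_index)
    have "m $ q = 0"
      using *[of q] assms by simp
    then have "m $ r = 0" for r
      using *[of r] assms by (cases "r = q") auto
    then show ?thesis
      by (simp add: vec_eq_iff)
  qed
  then show ?thesis
    unfolding invertible_left_inverse matrix_left_invertible_ker by blast
qed

section \<open>Sublattices given by integer matrices\<close>

lemma sublattice:
  fixes A B :: "real^'m^'m"
  assumes A: "invertible A" and B: "invertible B"
    and int: "\<And>m i. (\<And>i. m $ i \<in> \<int>) \<Longrightarrow> (B *v m) $ i \<in> \<int>"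
    and L_def: "L = (\<lambda>k. (A ** B) *v k) ` {k. \<forall>i. k $ i \<in> \<int>}"
  shows "is_lattice L"
    and "L \<subseteq> (\<lambda>k. A *v k) ` {k. \<forall>i. k $ i \<in> \<int>}"
    and "A *v k \<in> L \<longleftrightarrow> (\<exists>m. (\<forall>i. m $ i \<in> \<int>) \<and> B *v m = k)"
proof -
  show "is_lattice L"
    unfolding is_lattice_def L_def using invertible_mult[OF A B] by blast
  have L: "L = (\<lambda>k. A *v (B *v k)) ` {k. \<forall>i. k $ i \<in> \<int>}"
    by (simp add: L_def matrix_vector_mul_assoc)
  show "L \<subseteq> (\<lambda>k. A *v k) ` {k. \<forall>i. k $ i \<in> \<int>}"
    unfolding L using int by auto
  show "A *v k \<in> L \<longleftrightarrow> (\<exists>m. (\<forall>i. m $ i \<in> \<int>) \<and> B *v m = k)"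
    unfolding L using inj_matrix_vector_mult[OF A] by (auto simp: inj_eq)
qed

lemma column_matrix_Ints:
  assumes "\<And>i. v $ i \<in> \<int>" "N \<in> \<int>" "\<And>i. m $ i \<in> \<int>"
  shows "(column_matrix q v N *v m) $ r \<in> \<int>"
  using assms by (simp add: column_matrix_mult)

text \<open>A nonzero integer multiple of \<bar>k\<bar> + 1 is larger in modulus than
  \<open>k\<close>.\<close>

lemma Ints_eq_mult_imp_0:
  fixes k m N :: real
  assumes "k \<in> \<int>" "m \<in> \<int>" "k = (\<bar>k\<bar> + 1) * m"
  shows "k = 0"
proof (rule ccontr)
  assume "k \<noteq> 0"
  then have "m \<noteq> 0" using assms(3) by auto
  with assms(2) have "1 \<le> \<bar>m\<bar>"
    by (rule Ints_nonzero_abs_ge1)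
  then have "(\<bar>k\<bar> + 1) * 1 \<le> (\<bar>k\<bar> + 1) * \<bar>m\<bar>"
    by (intro mult_left_mono) auto
  also have "\<dots> = \<bar>k\<bar>"
    by (subst (2) assms(3)) (simp add: abs_mult)
  finally show False by simp
qed

lemma Ints_mult_eq_1:
  fixes k m :: real
  assumes "k \<in> \<int>" "m \<in> \<int>" "k * m = 1"
  shows "k = 1 \<or> k = - 1"
proof -
  obtain a b :: int where "k = a" "m = b"
    using assms(1,2) by (auto elim!: Ints_cases)
  with assms(3) have "a * b = 1"
    by (metis of_int_eq_1_iff of_int_mult)
  then show ?thesis
    using \<open>k = a\<close> by (auto simp: zmult_eq_1_iff)
qed

lemma sublattice_avoiding:
  fixes A :: "real^'m^'m"
  assumes A: "invertible A" and k: "\<And>i. k $ i \<in> \<int>" "k \<noteq> 0"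
  shows "\<exists>\<Lambda>. is_lattice \<Lambda> \<and> \<Lambda> \<subseteq> (\<lambda>k. A *v k) ` {k. \<forall>i. k $ i \<in> \<int>} \<and> A *v k \<notin> \<Lambda>"
proof -
  obtain j where j: "k $ j \<noteq> 0"
    using k(2) by (auto simp: vec_eq_iff)
  define N where "N = \<bar>k $ j\<bar> + 1"
  \<comment> \<open>This is \<open>N\<close> times the identity, so all coordinates in the
    sublattice are multiples of \<open>N\<close>, whereas \<open>k $ j\<close> is nonzero and
    smaller than \<open>N\<close> in modulus.\<close>
  define B where "B = column_matrix j (axis j N) N"
  have N: "N \<noteq> 0" "N \<in> \<int>"
    using k(1)[of j] by (auto simp: N_def)
  have B: "invertible B"
    unfolding B_def using N by (intro invertible_column_matrix) (auto simp: axis_def)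
  have int: "(B *v m) $ i \<in> \<int>" if "\<And>i. m $ i \<in> \<int>" for m i
    unfolding B_def using N that by (intro column_matrix_Ints) (auto simp: axis_def)
  have "\<not> (\<exists>m. (\<forall>i. m $ i \<in> \<int>) \<and> B *v m = k)"
  proof safe
    fix m assume m: "\<forall>i. m $ i \<in> \<int>" "k = B *v m"
    then have "k $ j = N * m $ j"
      using column_matrix_mult[of j "axis j N" N m j] by (simp add: B_def axis_def)
    then show False
      using Ints_eq_mult_imp_0[of "k $ j" "m $ j"] k(1) m(1) j by (simp add: N_def)
  qed
  then show ?thesis
    using sublattice[OF A B int refl] by blast
qed

text \<open>If coordinate \<open>q\<close> of \<open>k\<close> vanishes, requiring this coordinate
  to be even keeps \<open>k\<close> and excludes the basis vector. Otherwise \<open>k\<close> itself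
  is made a basis vector of the sublattice, next to large multiples of the other basis
  vectors.\<close>

lemma sublattice_separating:
  fixes A :: "real^'m^'m"
  assumes A: "invertible A" and k: "\<And>i. k $ i \<in> \<int>" "k \<noteq> axis q 1" "k \<noteq> - axis q 1"
  shows "\<exists>\<Lambda>. is_lattice \<Lambda> \<and> \<Lambda> \<subseteq> (\<lambda>k. A *v k) ` {k. \<forall>i. k $ i \<in> \<int>} \<and>
    A *v k \<in> \<Lambda> \<and> A *v axis q 1 \<notin> \<Lambda>"
proof (cases "k $ q = 0")
  case True
  define B :: "real^'m^'m" where "B = column_matrix q (axis q 2) 1"
  have B: "invertible B"
    unfolding B_def by (intro invertible_column_matrix) (auto simp: axis_def)
  have int: "(B *v m) $ i \<in> \<int>" if "\<And>i. m $ i \<in> \<int>" for m i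
    unfolding B_def using that by (intro column_matrix_Ints) (auto simp: axis_def)
  have "B *v k = k"
    using True by (auto simp: B_def vec_eq_iff column_matrix_mult axis_def)
  moreover have "\<not> (\<exists>m. (\<forall>i. m $ i \<in> \<int>) \<and> B *v m = axis q 1)"
  proof safe
    fix m assume m: "\<forall>i. m $ i \<in> \<int>" "B *v m = axis q 1"
    then have "2 * m $ q = 1"
      using column_matrix_mult[of q "axis q 2" 1 m q] by (simp add: B_def axis_def)
    then show False
      using Ints_mult_eq_1[of 2 "m $ q"] m(1) by simp
  qed
  ultimately show ?thesis
    using sublattice[OF A B int refl] k(1)
    by (intro exI[of _ "(\<lambda>k. (A ** B) *v k) ` {k. \<forall>i. k $ i \<in> \<int>}"]) auto
next
  case False
  \<comment> \<open>If \<open>k\<close> has a nonzero entry off \<open>q\<close>, then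
    \<open>N\<close> exceeds one such entry in modulus, so that this entry is not a multiple of
    \<open>N\<close>. If there is none, \<open>N = 1\<close> suffices.\<close>
  define N where "N = (if \<exists>j. j \<noteq> q \<and> k $ j \<noteq> 0 then \<bar>k $ (SOME j. j \<noteq> q \<and> k $ j \<noteq> 0)\<bar> + 1 else 1)"
  define B where "B = column_matrix q k N"
  have N: "N \<noteq> 0" "N \<in> \<int>"
    using k(1) by (auto simp: N_def)
  have B: "invertible B"
    unfolding B_def using N False by (intro invertible_column_matrix) auto
  have int: "(B *v m) $ i \<in> \<int>" if "\<And>i. m $ i \<in> \<int>" for m i
    unfolding B_def using N k(1) that by (intro column_matrix_Ints) auto
  have "B *v axis q 1 = k"
    by (simp add: B_def column_matrix_mult_axis)
  moreover have "\<forall>i. (axis q 1 :: real^'m) $ i \<in> \<int>"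
    by (auto simp: axis_def)
  moreover have "\<not> (\<exists>m. (\<forall>i. m $ i \<in> \<int>) \<and> B *v m = axis q 1)"
  proof safe
    fix m assume m: "\<forall>i. m $ i \<in> \<int>" "B *v m = axis q 1"
    have comp: "(if r = q then 1 else 0) = k $ r * m $ q + (if r = q then 0 else N * m $ r)" for r
      using column_matrix_mult[of q k N m r] m(2) by (simp add: B_def axis_def eq_commute[of r q])
    \<comment> \<open>Row \<open>q\<close> of the equation reads \<open>k $ q * m $ q = 1\<close> in
      integers. With \<open>m $ q\<close> a unit, every other row makes \<open>k $ r\<close> a
      multiple of \<open>N\<close>.\<close>
    have kq: "k $ q = 1 \<or> k $ q = - 1" and mq: "m $ q = 1 \<or> m $ q = - 1"
      using comp[of q] Ints_mult_eq_1[of "k $ q" "m $ q"] Ints_mult_eq_1[of "m $ q" "k $ q"] k(1) m(1)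
      by (auto simp: mult.commute)
    show False
    proof (cases "\<exists>j. j \<noteq> q \<and> k $ j \<noteq> 0")
      case True
      define j where "j = (SOME j. j \<noteq> q \<and> k $ j \<noteq> 0)"
      have j: "j \<noteq> q" "k $ j \<noteq> 0"
        using someI_ex[OF True] by (auto simp: j_def)
      have "N = \<bar>k $ j\<bar> + 1"
        using True by (simp add: N_def j_def)
      moreover have "k $ j = N * (m $ j) \<or> k $ j = N * (- m $ j)"
        using comp[of j] j(1) mq by auto
      ultimately show False
        using Ints_eq_mult_imp_0[of "k $ j" "m $ j"] Ints_eq_mult_imp_0[of "k $ j" "- m $ j"] k(1) m(1) j(2)
        by auto
    next
      case False
      then have "k $ r = (if r = q then k $ q else 0)" for r
        by auto
      note kr = this
      from kq have "k = axis q 1 \<or> k = - axis q 1"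
      proof
        assume "k $ q = 1"
        then have "k $ r = axis q 1 $ r" for r
          using kr[of r] by (simp add: axis_def)
        then show ?thesis by (simp add: vec_eq_iff)
      next
        assume "k $ q = - 1"
        then have "k $ r = (- axis q 1) $ r" for r
          using kr[of r] by (simp add: axis_def)
        then have "k = - axis q 1" unfolding vec_eq_iff by blast
        then show ?thesis ..
      qed
      with k(2,3) show False by blast
    qed
  qed
  ultimately show ?thesis
    using sublattice[OF A B int refl]
    by (intro exI[of _ "(\<lambda>k. (A ** B) *v k) ` {k. \<forall>i. k $ i \<in> \<int>}"]) auto
qed

text \<open>The lattice is twice the integer lattice with the basis vector at the position index
  \<open>q\<close> replaced by \<open>z\<close>. A nonzero position coefficient displaces the cube
  by at least 2 in some coordinate; otherwise the lattice vector is a pure modulation with even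
  integer frequencies.\<close>

lemma gabor_primitive_cube_window:
  fixes z :: "real^('n::finite + 'n)"
  assumes z: "2 \<le> \<bar>z $ Inl i\<bar>"
  shows "\<exists>\<Lambda>. gabor_primitive cube_window \<Lambda> z"
proof -
  define q :: "'n + 'n" where "q = Inl i"
  define A where "A = column_matrix q z 2"
  let ?L = "(\<lambda>k. A *v k) ` {k. \<forall>i. k $ i \<in> \<int>}"
  have A: "invertible A"
    unfolding A_def using z by (intro invertible_column_matrix) (auto simp: q_def)
  have lat: "is_lattice ?L"
    unfolding is_lattice_def using A by blast
  have z_eq: "z = A *v axis q 1"
    by (simp add: A_def column_matrix_mult_axis)
  have z_mem: "z \<in> ?L"
    unfolding z_eq by (rule imageI) (auto simp: axis_def)
  have orth: "gabor_orthogonal cube_window ?L"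
    unfolding gabor_orthogonal_def
  proof (intro ballI impI, elim imageE CollectE)
    fix w m assume w: "w \<noteq> 0" "w = A *v m" and m: "\<forall>i. m $ i \<in> \<int>"
    have comp: "w $ r = z $ r * m $ q + (if r = q then 0 else 2 * m $ r)" for r
      by (simp add: w(2) A_def column_matrix_mult)
    show "cinner_l2 cube_window (tf_shift w cube_window) = 0"
    proof (cases "\<exists>j. m $ (Inl j) \<noteq> 0")
      case True
      have "\<exists>j. 1 < \<bar>position w $ j\<bar>"
      proof (cases "m $ q = 0")
        case True
        then obtain j where j: "m $ (Inl j) \<noteq> 0" "Inl j \<noteq> q"
          using \<open>\<exists>j. m $ (Inl j) \<noteq> 0\<close> by metis
        then have "1 \<le> \<bar>m $ (Inl j)\<bar>"
          using m by (intro Ints_nonzero_abs_ge1) auto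
        then show ?thesis
          using comp[of "Inl j"] j True by (intro exI[of _ j]) (simp add: position_def)
      next
        case False
        then have "1 \<le> \<bar>m $ q\<bar>"
          using m by (intro Ints_nonzero_abs_ge1) auto
        then have "2 * 1 \<le> \<bar>z $ q\<bar> * \<bar>m $ q\<bar>"
          using z by (intro mult_mono) (auto simp: q_def)
        then show ?thesis
          using comp[of q] by (intro exI[of _ i]) (simp add: position_def q_def abs_mult)
      qed
      then show ?thesis
        using cinner_cube_window_disjoint by blast
    next
      case False
      \<comment> \<open>As \<open>q\<close> is a position index, the column \<open>z\<close>, with
        its arbitrary frequencies, does not contribute in this case.\<close>
      then have "m $ q = 0" by (simp add: q_def)
      then have comp': "w $ r = (if r = q then 0 else 2 * m $ r)" for r
        using comp by simp
      have "position w = 0"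
        using False comp' by (simp add: position_def vec_eq_iff)
      obtain r where "w $ r \<noteq> 0"
        using w(1) by (auto simp: vec_eq_iff)
      moreover obtain j where "r = Inr j"
        using \<open>w $ r \<noteq> 0\<close> False comp' by (cases r) (auto split: if_splits)
      ultimately have "frequency w $ j \<in> \<int>" "frequency w $ j \<noteq> 0"
        using comp'[of "Inr j"] m by (auto simp: frequency_def q_def)
      with \<open>position w = 0\<close> show ?thesis
        by (rule cinner_cube_window_modulation)
    qed
  qed
  have "gabor_primitive cube_window ?L z"
    unfolding gabor_primitive_def
  proof (intro conjI ballI impI lat orth z_mem; (elim imageE CollectE)?)
    show "z \<noteq> 0" using z by auto
  next
    fix w k assume "w \<noteq> 0" "w = A *v k" "\<forall>i. k $ i \<in> \<int>"
    moreover from this have "k \<noteq> 0" by auto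
    ultimately show "\<exists>\<Lambda>. is_lattice \<Lambda> \<and> \<Lambda> \<subseteq> ?L \<and> w \<notin> \<Lambda>"
      using sublattice_avoiding[OF A, of k] by auto
  next
    fix w k assume w: "w \<noteq> z" "w \<noteq> - z" "w = A *v k" "\<forall>i. k $ i \<in> \<int>"
    have "A *v (- axis q 1) = - z"
      using matrix_vector_mult_diff_distrib[of A 0 "axis q 1"] by (simp add: z_eq)
    with w have "k \<noteq> axis q 1" "k \<noteq> - axis q 1"
      using z_eq by auto
    then show "\<exists>\<Lambda>. is_lattice \<Lambda> \<and> \<Lambda> \<subseteq> ?L \<and> w \<in> \<Lambda> \<and> z \<notin> \<Lambda>"
      using sublattice_separating[OF A, of k q] w(3,4) z_eq by auto
  qed
  then show ?thesis by blast
qed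

section \<open>The symplectic form\<close>

lemma inner_position_frequency: "z \<bullet> w = position z \<bullet> position w + frequency z \<bullet> frequency w"
proof -
  have "z \<bullet> w = (\<Sum>i\<in>range Inl \<union> range Inr. z $ i * w $ i)"
    by (simp add: inner_vec_def UNIV_sum)
  also have "\<dots> = (\<Sum>i\<in>range Inl. z $ i * w $ i) + (\<Sum>i\<in>range Inr. z $ i * w $ i)"
    by (intro sum.union_disjoint) auto
  finally show ?thesis
    by (simp add: inner_vec_def position_def frequency_def sum.reindex)
qed

lemma
  position_block_matrix: "position (block_matrix A B C D *v z) = A *v position z + B *v frequency z"
  and frequency_block_matrix: "frequency (block_matrix A B C D *v z) = C *v position z + D *v frequency z"
proof -
  have split: "(\<Sum>j\<in>UNIV. f j) = (\<Sum>j\<in>UNIV. f (Inl j)) + (\<Sum>j\<in>UNIV. f (Inr j))"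
    for f :: "'a + 'a \<Rightarrow> real"
    unfolding UNIV_sum by (subst sum.union_disjoint) (auto simp: sum.reindex)
  show "position (block_matrix A B C D *v z) = A *v position z + B *v frequency z"
    "frequency (block_matrix A B C D *v z) = C *v position z + D *v frequency z"
    by (simp_all add: vec_eq_iff position_def frequency_def matrix_vector_mult_def block_matrix_def split)
qed

lemma uminus_matrix_vector_mult: "(- A) *v x = - (A *v x)" for A :: "real^'n^'m"
  using matrix_vector_mult_diff_rdistrib[of 0 A x] by simp

lemma symplectic_form_eq_inner: "symplectic_form z w = z \<bullet> (symplectic_form_matrix *v w)"
  by (simp add: symplectic_form_def inner_position_frequency symplectic_form_matrix_def
    position_block_matrix frequency_block_matrix uminus_matrix_vector_mult inner_commute)

lemma
  position_reflection: "position (reflection_matrix *v z) = position z"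
  and frequency_reflection: "frequency (reflection_matrix *v z) = - frequency z"
  by (simp_all add: reflection_matrix_def position_block_matrix frequency_block_matrix
    uminus_matrix_vector_mult)

lemma position_frequency_eqI: "position z = position w \<Longrightarrow> frequency z = frequency w \<Longrightarrow> z = w"
  unfolding vec_eq_iff position_def frequency_def vec_lambda_beta by (metis old.sum.exhaust)

lemma invertible_reflection_matrix:
  "invertible (reflection_matrix :: real^('n::finite + 'n)^('n + 'n))"
proof -
  have "reflection_matrix ** reflection_matrix = (mat 1 :: real^('n + 'n)^('n + 'n))"
    unfolding matrix_eq matrix_vector_mul_assoc[symmetric]
    by (auto intro!: position_frequency_eqI simp: position_reflection frequency_reflection)
  then show ?thesis
    unfolding invertible_def by blast
qed

text \<open>The form is the bilinear form of \<open>symplectic_form_matrix\<close>; moving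
  \<open>S\<close> across the inner product as its transpose turns invariance of the form into the
  matrix identity.\<close>

lemma symplecticI:
  assumes "invertible S" and "\<And>z w. symplectic_form (S *v z) (S *v w) = symplectic_form z w"
  shows "symplectic S"
proof -
  have "transpose S ** symplectic_form_matrix ** S *v w = symplectic_form_matrix *v w" for w
  proof (rule vector_eq_ldot[THEN iffD1], rule allI)
    fix z
    have "z \<bullet> (transpose S ** symplectic_form_matrix ** S *v w) =
        (S *v z) \<bullet> (symplectic_form_matrix *v (S *v w))"
      by (simp only: dot_lmul_matrix[symmetric] matrix_vector_mul_assoc[symmetric]
        vector_transpose_matrix)
    then show "z \<bullet> (transpose S ** symplectic_form_matrix ** S *v w) = z \<bullet> (symplectic_form_matrix *v w)"
      using assms(2)[of z w] by (simp only: symplectic_form_eq_inner)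
  qed
  with assms(1) show ?thesis
    unfolding symplectic_def matrix_eq by blast
qed

section \<open>From pointwise signs to a uniform sign\<close>

lemma linear_symplectic_form:
  "linear (symplectic_form z)" "linear (\<lambda>z. symplectic_form z w)"
  unfolding symplectic_form_eq_inner[abs_def]
  by (auto intro!: linearI simp: matrix_vector_right_distrib inner_simps matrix_vector_mult_scaleR)

text \<open>If \<open>a\<close> lies outside \<open>S\<close> and \<open>b\<close> outside
  \<open>S'\<close>, then \<open>a + b\<close> lies in neither.\<close>

lemma subspace_Un_eq_UNIV:
  assumes "subspace S" "subspace S'" "S \<union> S' = UNIV"
  shows "S = UNIV \<or> S' = UNIV"
proof (rule ccontr)
  assume "\<not> ?thesis"
  then obtain a b where "a \<notin> S" "b \<notin> S'" by blast
  with assms(3) have "a \<in> S'" "b \<in> S" by blast+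
  from assms(3) consider "a + b \<in> S" | "a + b \<in> S'" by blast
  then show False
  proof cases
    case 1
    with subspace_diff[OF assms(1) this \<open>b \<in> S\<close>] \<open>a \<notin> S\<close> show False by simp
  next
    case 2
    with subspace_diff[OF assms(2) this \<open>a \<in> S'\<close>] \<open>b \<notin> S'\<close> show False by simp
  qed
qed

text \<open>Equality of squares extends from the complement of a hyperplane to the whole space. The
  sets where the two signs hold are then subspaces that cover everything.\<close>

lemma linear_eq_up_to_sign:
  fixes L M :: "real^'m \<Rightarrow> real"
  assumes L: "linear L" and M: "linear M"
    and eq: "\<And>w. w $ q \<noteq> 0 \<Longrightarrow> L w = M w \<or> L w = - M w"
  shows "(\<forall>w. L w = M w) \<or> (\<forall>w. L w = - M w)"
proof -
  have sq: "(L w)\<^sup>2 = (M w)\<^sup>2" for w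
  proof (cases "w $ q = 0")
    case True
    let ?u = "axis q 1"
    have "(L w + c * L ?u)\<^sup>2 = (M w + c * M ?u)\<^sup>2" if "c \<noteq> 0" for c
    proof -
      have "(w + c *\<^sub>R ?u) $ q \<noteq> 0"
        using True that by (simp add: axis_def)
      from eq[OF this] show ?thesis
        unfolding power2_eq_iff
        by (simp only: linear_add[OF L] linear_add[OF M] linear_cmul[OF L] linear_cmul[OF M] real_scaleR_def)
    qed
    \<comment> \<open>Both sides are polynomials of degree at most 2 in \<open>c\<close>; agreement
      at three points forces equal constant terms.\<close>
    from this[of 1] this[of "-1"] this[of 2] show ?thesis
      by (simp add: power2_eq_square algebra_simps)
  next
    case False
    then show ?thesis unfolding power2_eq_iff using eq by blast
  qed
  have "subspace {w. L w = M w}" "subspace {w. L w = - M w}"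
    by (auto intro!: subspaceI simp: linear_add[OF L] linear_add[OF M] linear_cmul[OF L] linear_cmul[OF M]
      linear_0[OF L] linear_0[OF M])
  moreover have "{w. L w = M w} \<union> {w. L w = - M w} = UNIV"
    using sq by (auto simp: power2_eq_iff)
  ultimately show ?thesis
    using subspace_Un_eq_UNIV by blast
qed

lemma countable_mult_in_Ints:
  fixes c :: real
  assumes "c \<noteq> 0"
  shows "countable {s. s * c \<in> \<int>}"
proof (rule countable_subset)
  show "{s. s * c \<in> \<int>} \<subseteq> range (\<lambda>n :: int. of_int n / c)"
  proof
    fix s assume "s \<in> {s. s * c \<in> \<int>}"
    then obtain n where "s * c = of_int n"
      by (auto elim: Ints_cases)
    with assms show "s \<in> range (\<lambda>n :: int. of_int n / c)"
      by (intro image_eqI[of _ _ n]) (auto simp: field_simps)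
  qed
qed simp

context gabor_covariance
begin

text \<open>
  The relation modulo 1 holds for all \<open>s w\<close> with \<open>s\<close> large; were neither equality true, it would
  hold for countably many \<open>s\<close> only.
\<close>

lemma symplectic_form_T_eq:
  assumes "z $ Inl i \<noteq> 0" "w $ Inl i \<noteq> 0"
  shows "symplectic_form (T *v z) (T *v w) = symplectic_form z w \<or>
    symplectic_form (T *v z) (T *v w) = - symplectic_form z w"
proof (rule ccontr)
  assume ne: "\<not> ?thesis"
  \<comment> \<open>The factor \<open>r\<close> gives coordinate \<open>i\<close> of
    \<open>z\<close> modulus exactly 2, and any \<open>s \<ge> s0\<close> gives that of
    \<open>w\<close> modulus at least 2. These vectors and their doubles are therefore primitive in
    suitable lattices.\<close>
  define r where "r = 2 / \<bar>z $ Inl i\<bar>"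
  define s0 where "s0 = 2 / \<bar>w $ Inl i\<bar>"
  let ?b = "symplectic_form (T *v z) (T *v w)" and ?c = "symplectic_form z w"
  have "r > 0" "s0 > 0"
    using assms by (auto simp: r_def s0_def)
  have "s * (r * (?b - ?c)) \<in> \<int> \<or> s * (r * (?b + ?c)) \<in> \<int>" if "s \<ge> s0" for s
  proof -
    have z2: "2 \<le> \<bar>(r *\<^sub>R z) $ Inl i\<bar>"
      using assms by (simp add: r_def abs_mult)
    have "s0 * \<bar>w $ Inl i\<bar> \<le> s * \<bar>w $ Inl i\<bar>"
      using that by (intro mult_right_mono) auto
    moreover have "s > 0"
      using that \<open>s0 > 0\<close> by linarith
    ultimately have w2: "2 \<le> \<bar>(s *\<^sub>R w) $ Inl i\<bar>"
      using assms by (simp add: s0_def abs_mult)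
    from z2 w2 have "2 \<le> \<bar>(r *\<^sub>R z + r *\<^sub>R z) $ Inl i\<bar>" "2 \<le> \<bar>(s *\<^sub>R w + s *\<^sub>R w) $ Inl i\<bar>"
      unfolding vector_add_component by linarith+
    with z2 w2 obtain \<Lambda>0 \<Lambda>1 \<Lambda>2 \<Lambda>3 where
      "gabor_primitive cube_window \<Lambda>0 (r *\<^sub>R z)" "gabor_primitive cube_window \<Lambda>1 (r *\<^sub>R z + r *\<^sub>R z)"
      "gabor_primitive cube_window \<Lambda>2 (s *\<^sub>R w)" "gabor_primitive cube_window \<Lambda>3 (s *\<^sub>R w + s *\<^sub>R w)"
      using gabor_primitive_cube_window by metis
    from symplectic_form_T_mod_1[OF this norm_cube_window] show ?thesis
      by (simp add: matrix_vector_mult_scaleR linear_cmul[OF linear_symplectic_form(1)]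
        linear_cmul[OF linear_symplectic_form(2)] algebra_simps)
  qed
  then have "s \<in> {s. s * (r * (?b - ?c)) \<in> \<int>} \<union> {s. s * (r * (?b + ?c)) \<in> \<int>}"
    if "s \<in> {s0..s0 + 1}" for s
    using that unfolding Un_iff mem_Collect_eq atLeastAtMost_iff by blast
  then have "{s0..s0 + 1} \<subseteq> {s. s * (r * (?b - ?c)) \<in> \<int>} \<union> {s. s * (r * (?b + ?c)) \<in> \<int>}"
    by (rule subsetI)
  moreover have "countable ({s. s * (r * (?b - ?c)) \<in> \<int>} \<union> {s. s * (r * (?b + ?c)) \<in> \<int>})"
    using ne \<open>r > 0\<close> by (intro countable_Un countable_mult_in_Ints) auto
  ultimately have "countable {s0..s0 + 1}"
    by (rule countable_subset)
  then show False
    using uncountable_closed_interval[of s0 "s0 + 1"] by simp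
qed

lemma symplectic_form_T:
  "(\<forall>z w. symplectic_form (T *v z) (T *v w) = symplectic_form z w) \<or>
    (\<forall>z w. symplectic_form (T *v z) (T *v w) = - symplectic_form z w)"
proof -
  let ?b = "\<lambda>z w. symplectic_form (T *v z) (T *v w)"
  \<comment> \<open>Any position coordinate will do; one exists because types are nonempty.\<close>
  obtain i :: 'n where True by simp
  have lin: "linear (?b z)" "linear (\<lambda>z. ?b z w)" for z w
    using linear_compose[OF matrix_vector_mul_linear[of T] linear_symplectic_form(1)[of "T *v z"]]
      linear_compose[OF matrix_vector_mul_linear[of T] linear_symplectic_form(2)[of "T *v w"]]
    by (auto simp: comp_def)
  have "(\<forall>w. ?b z w = symplectic_form z w) \<or> (\<forall>w. ?b z w = - symplectic_form z w)"
    if "z $ Inl i \<noteq> 0" for z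
    by (rule linear_eq_up_to_sign[OF lin(1) linear_symplectic_form(1)]) (rule symplectic_form_T_eq[OF that])
  \<comment> \<open>The roles are exchanged: for fixed \<open>w\<close> the identity up to sign is
    known for all \<open>z\<close> off a hyperplane, hence with one sign for all \<open>z\<close>.
    Only the dependence of this sign on \<open>w\<close> remains.\<close>
  then have *: "(\<forall>z. ?b z w = symplectic_form z w) \<or> (\<forall>z. ?b z w = - symplectic_form z w)" for w
    by (intro linear_eq_up_to_sign[OF lin(2) linear_symplectic_form(2), of "Inl i"]) blast
  have sub: "subspace {w. \<forall>z. ?b z w = symplectic_form z w}" "subspace {w. \<forall>z. ?b z w = - symplectic_form z w}"
    by (auto intro!: subspaceI simp: linear_add[OF lin(1)] linear_cmul[OF lin(1)] linear_0[OF lin(1)]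
      linear_add[OF linear_symplectic_form(1)] linear_cmul[OF linear_symplectic_form(1)]
      linear_0[OF linear_symplectic_form(1)])
  have "{w. \<forall>z. ?b z w = symplectic_form z w} \<union> {w. \<forall>z. ?b z w = - symplectic_form z w} = UNIV"
    using * by blast
  from subspace_Un_eq_UNIV[OF sub this] show ?thesis by blast
qed

end

theorem theorem5p3:
  fixes T :: "real^('n::finite + 'n)^('n + 'n)"
  assumes "invertible T"
    and "\<exists>F :: 'n l2 \<Rightarrow> 'n l2.
      (linear_l2 F \<or> antilinear_l2 F) \<and> bounded_l2 F \<and> bij F \<and>
      (\<forall>\<Lambda> g h. is_lattice \<Lambda> \<longrightarrow>
        (bessel (F g) ((\<lambda>z. T *v z) ` \<Lambda>) \<longleftrightarrow> bessel g \<Lambda>) \<and>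
        (bessel g \<Lambda> \<and> bessel h \<Lambda> \<longrightarrow>
          F \<circ> frame_op \<Lambda> g h \<circ> inv F = frame_op ((\<lambda>z. T *v z) ` \<Lambda>) (F g) (F h)))"
  shows "symplectic T \<or> symplectic (reflection_matrix ** T)"
proof -
  obtain F :: "'n l2 \<Rightarrow> 'n l2" where lin: "linear_l2 F \<or> antilinear_l2 F" and bij: "bij F"
    and cov: "\<And>\<Lambda> g h. is_lattice \<Lambda> \<Longrightarrow> bessel g \<Lambda> \<Longrightarrow> bessel h \<Lambda> \<Longrightarrow>
      F \<circ> frame_op \<Lambda> g h \<circ> inv F = frame_op ((\<lambda>z. T *v z) ` \<Lambda>) (F g) (F h)"
    using assms(2) by meson
  obtain \<kappa> where \<kappa>: "\<kappa> = id \<or> \<kappa> = cnj"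
    and F: "\<And>\<alpha> \<beta> f g. F (\<alpha> *\<^sub>C f + \<beta> *\<^sub>C g) = \<kappa> \<alpha> *\<^sub>C F f + \<kappa> \<beta> *\<^sub>C F g"
    using lin unfolding linear_l2_def antilinear_l2_def by (metis id_apply)
  have F_add: "F (f + g) = F f + F g" for f g
    using F[of 1 f 1 g] \<kappa> by auto
  have F_scaleC: "F (c *\<^sub>C f) = \<kappa> c *\<^sub>C F f" for c f
    using F[of c f 0 0] \<kappa> by auto
  interpret gabor_covariance F T \<kappa>
    using assms(1) \<kappa> F_add F_scaleC bij cov by unfold_locales
  from symplectic_form_T show ?thesis
  proof
    assume "\<forall>z w. symplectic_form (T *v z) (T *v w) = symplectic_form z w"
    then show ?thesis
      using symplecticI[OF invertible_T] by blast
  next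
    assume "\<forall>z w. symplectic_form (T *v z) (T *v w) = - symplectic_form z w"
    \<comment> \<open>The reflection negates frequencies only, so it reverses the sign of the form
      and cancels the sign produced by \<open>T\<close>.\<close>
    then have "symplectic_form ((reflection_matrix ** T) *v z) ((reflection_matrix ** T) *v w) = symplectic_form z w" for z w
      by (simp add: symplectic_form_def position_reflection frequency_reflection
        flip: matrix_vector_mul_assoc)
    then show ?thesis
      using symplecticI[OF invertible_mult[OF invertible_reflection_matrix invertible_T]] by blast
  qed
qed

end
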